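(* Let $A$ and $B$ be unital $C^*$-algebras and let $\varphi : A \to B$ be a map (not assumed linear). Then the following are equivalent: (1) $\varphi$ is of boundedly positive type. (2) There exist a unital $C^*$-algebra $C$, a *-multiplicative map $\varphi_1 : A \to C$ and a positive linear map $\varphi_2 : C \to B$ such that $\varphi = \varphi_2 \circ \varphi_1$.
   Context: Let $A$, $B$ be $C^*$-algebras. A (not necessarily linear) map $\varphi : A \to B$ is said to be of boundedly positive type if for any $a \in A$ there exists a constant $K = K_a > 0$ such that for any finite subset $\{a_1,\dots,a_n\} \subset A$ and any finite subset $\{\alpha_1,\dots,\alpha_n\} \subset \mathbb{C}$ (that is, for any $n$, any $a_1,\dots,a_n\in A$ and any $\alpha_1,\dots,\alpha_n\in\mathbb{C}$), $$0 \leq \sum_{i=1}^{n}\sum_{j=1}^{n} \overline{\alpha_i}\alpha_j\, \varphi(a_i^*a^*aa_j) \leq K \sum_{i=1}^{n}\sum_{j=1}^{n} \overline{\alpha_i}\alpha_j\, \varphi(a_i^*a_j)$$ in the order of $B$. A (not necessarily linear) map $\psi : A \to B$ is *-multiplicative if $\psi(ab) = \psi(a)\psi(b)$ and $\psi(a^* ) = \psi(a)^*$ for all $a, b \in A$; no preservation of units is required. A linear map is positive if it sends positive elements to positive elements. *)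

theory Defs
  imports Complex_Main "HOL-Algebra.Ring"
begin

section \<open>Unital C*-algebras as a type class\<close>

text \<open>
  The unit is provided by \<^class>\<open>monoid_mult\<close> rather than by \<^class>\<open>real_normed_algebra_1\<close>, so that
  the zero algebra is included; in the nonzero case \<open>norm 1 = 1\<close> follows from the C*-identity.
  Submultiplicativity of the norm comes from \<^class>\<open>real_normed_algebra\<close>.
\<close>

class unital_cstar_algebra = real_normed_algebra + monoid_mult + banach +
  fixes scaleC :: "complex \<Rightarrow> 'a \<Rightarrow> 'a"  (infixr \<open>*\<^sub>C\<close> 75)
    and star :: "'a \<Rightarrow> 'a"
  assumes scaleC_add_right: "c *\<^sub>C (x + y) = c *\<^sub>C x + c *\<^sub>C y"
    and scaleC_add_left: "(c + d) *\<^sub>C x = c *\<^sub>C x + d *\<^sub>C x"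
    and scaleC_scaleC: "c *\<^sub>C d *\<^sub>C x = (c * d) *\<^sub>C x"
    and scaleR_scaleC: "r *\<^sub>R x = complex_of_real r *\<^sub>C x"
    and mult_scaleC_left: "(c *\<^sub>C x) * y = c *\<^sub>C (x * y)"
    and mult_scaleC_right: "x * (c *\<^sub>C y) = c *\<^sub>C (x * y)"
    and norm_scaleC: "norm (c *\<^sub>C x) = cmod c * norm x"
    and star_add: "star (x + y) = star x + star y"
    and star_scaleC: "star (c *\<^sub>C x) = cnj c *\<^sub>C star x"
    and star_mult: "star (x * y) = star y * star x"
    and star_star: "star (star x) = x"
    and cstar_identity: "norm (star x * x) = (norm x)\<^sup>2"

definition cstar_positive :: "'a::unital_cstar_algebra \<Rightarrow> bool"
  where "cstar_positive a \<longleftrightarrow> (\<exists>x. a = star x * x)"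

definition cstar_le :: "'a::unital_cstar_algebra \<Rightarrow> 'a \<Rightarrow> bool"  (infix \<open>\<le>\<^sub>C\<close> 50)
  where "a \<le>\<^sub>C b \<longleftrightarrow> cstar_positive (b - a)"

definition boundedly_positive_type ::
    "('a::unital_cstar_algebra \<Rightarrow> 'b::unital_cstar_algebra) \<Rightarrow> bool"
  where "boundedly_positive_type \<phi> \<longleftrightarrow>
    (\<forall>a. \<exists>K::real. K > 0 \<and>
      (\<forall>(n::nat) (x::nat \<Rightarrow> 'a) (\<alpha>::nat \<Rightarrow> complex).
        0 \<le>\<^sub>C (\<Sum>i=1..n. \<Sum>j=1..n. (cnj (\<alpha> i) * \<alpha> j) *\<^sub>C \<phi> (star (x i) * star a * a * x j)) \<and>
        (\<Sum>i=1..n. \<Sum>j=1..n. (cnj (\<alpha> i) * \<alpha> j) *\<^sub>C \<phi> (star (x i) * star a * a * x j))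
          \<le>\<^sub>C K *\<^sub>R (\<Sum>i=1..n. \<Sum>j=1..n. (cnj (\<alpha> i) * \<alpha> j) *\<^sub>C \<phi> (star (x i) * x j))))"

section \<open>Unital C*-algebras on a carrier set\<close>

text \<open>
  Since HOL cannot quantify existentially over types, a C*-algebra whose existence is asserted is
  presented as a structure on a carrier set. The C*-algebra through which a map
  \<open>\<phi> :: 'a \<Rightarrow> 'b\<close> of boundedly positive type factors as \<open>\<phi>\<^sub>2 \<circ> \<phi>\<^sub>1\<close> may be taken to be the closed
  span of the image of \<open>\<phi>\<^sub>1\<close> in the GNS representation (over all states of \<open>'b\<close>); its elements \<open>T\<close>
  are determined by the functions \<open>\<lambda>a b. \<phi>\<^sub>2 (\<phi>\<^sub>1 (star a) \<otimes> T \<otimes> \<phi>\<^sub>1 b)\<close>, so a carrier inside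
  \<open>'a \<Rightarrow> 'a \<Rightarrow> 'b\<close> is large enough.
\<close>

record 'c cstar_structure = "'c ring" +
  cscale :: "complex \<Rightarrow> 'c \<Rightarrow> 'c"
  cstar :: "'c \<Rightarrow> 'c"
  cnorm :: "'c \<Rightarrow> real"

locale unital_cstar_structure = ring C for C :: "'c cstar_structure" (structure) +
  assumes cscale_closed: "x \<in> carrier C \<Longrightarrow> cscale C c x \<in> carrier C"
    and cscale_add_right: "\<lbrakk>x \<in> carrier C; y \<in> carrier C\<rbrakk> \<Longrightarrow>
      cscale C c (x \<oplus> y) = cscale C c x \<oplus> cscale C c y"
    and cscale_add_left: "x \<in> carrier C \<Longrightarrow> cscale C (c + d) x = cscale C c x \<oplus> cscale C d x"
    and cscale_cscale: "x \<in> carrier C \<Longrightarrow> cscale C c (cscale C d x) = cscale C (c * d) x"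
    and cscale_one: "x \<in> carrier C \<Longrightarrow> cscale C 1 x = x"
    and mult_cscale_left: "\<lbrakk>x \<in> carrier C; y \<in> carrier C\<rbrakk> \<Longrightarrow>
      cscale C c x \<otimes> y = cscale C c (x \<otimes> y)"
    and mult_cscale_right: "\<lbrakk>x \<in> carrier C; y \<in> carrier C\<rbrakk> \<Longrightarrow>
      x \<otimes> cscale C c y = cscale C c (x \<otimes> y)"
    and cnorm_nonneg: "x \<in> carrier C \<Longrightarrow> 0 \<le> cnorm C x"
    and cnorm_eq_0_iff: "x \<in> carrier C \<Longrightarrow> cnorm C x = 0 \<longleftrightarrow> x = \<zero>"
    and cnorm_add: "\<lbrakk>x \<in> carrier C; y \<in> carrier C\<rbrakk> \<Longrightarrow>
      cnorm C (x \<oplus> y) \<le> cnorm C x + cnorm C y"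
    and cnorm_cscale: "x \<in> carrier C \<Longrightarrow> cnorm C (cscale C c x) = cmod c * cnorm C x"
    and cnorm_mult: "\<lbrakk>x \<in> carrier C; y \<in> carrier C\<rbrakk> \<Longrightarrow>
      cnorm C (x \<otimes> y) \<le> cnorm C x * cnorm C y"
    and complete: "\<lbrakk>\<And>n::nat. s n \<in> carrier C;
        \<And>e. e > 0 \<Longrightarrow> \<exists>N. \<forall>m\<ge>N. \<forall>n\<ge>N. cnorm C (s m \<ominus> s n) < e\<rbrakk> \<Longrightarrow>
      \<exists>l\<in>carrier C. (\<lambda>n. cnorm C (s n \<ominus> l)) \<longlonglongrightarrow> 0"
    and cstar_closed: "x \<in> carrier C \<Longrightarrow> cstar C x \<in> carrier C"
    and cstar_add: "\<lbrakk>x \<in> carrier C; y \<in> carrier C\<rbrakk> \<Longrightarrow>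
      cstar C (x \<oplus> y) = cstar C x \<oplus> cstar C y"
    and cstar_cscale: "x \<in> carrier C \<Longrightarrow> cstar C (cscale C c x) = cscale C (cnj c) (cstar C x)"
    and cstar_mult: "\<lbrakk>x \<in> carrier C; y \<in> carrier C\<rbrakk> \<Longrightarrow>
      cstar C (x \<otimes> y) = cstar C y \<otimes> cstar C x"
    and cstar_cstar: "x \<in> carrier C \<Longrightarrow> cstar C (cstar C x) = x"
    and cnorm_cstar_mult: "x \<in> carrier C \<Longrightarrow> cnorm C (cstar C x \<otimes> x) = (cnorm C x)\<^sup>2"

definition positive_in :: "'c cstar_structure \<Rightarrow> 'c \<Rightarrow> bool"
  where "positive_in C a \<longleftrightarrow> (\<exists>x\<in>carrier C. a = cstar C x \<otimes>\<^bsub>C\<^esub> x)"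

definition star_multiplicative_into ::
    "'c cstar_structure \<Rightarrow> ('a::unital_cstar_algebra \<Rightarrow> 'c) \<Rightarrow> bool"
  where "star_multiplicative_into C \<psi> \<longleftrightarrow>
    (\<forall>a. \<psi> a \<in> carrier C) \<and>
    (\<forall>a b. \<psi> (a * b) = \<psi> a \<otimes>\<^bsub>C\<^esub> \<psi> b) \<and>
    (\<forall>a. \<psi> (star a) = cstar C (\<psi> a))"

definition positive_linear_from ::
    "'c cstar_structure \<Rightarrow> ('c \<Rightarrow> 'b::unital_cstar_algebra) \<Rightarrow> bool"
  where "positive_linear_from C \<psi> \<longleftrightarrow>
    (\<forall>x\<in>carrier C. \<forall>y\<in>carrier C. \<psi> (x \<oplus>\<^bsub>C\<^esub> y) = \<psi> x + \<psi> y) \<and>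
    (\<forall>c. \<forall>x\<in>carrier C. \<psi> (cscale C c x) = c *\<^sub>C \<psi> x) \<and>
    (\<forall>x\<in>carrier C. positive_in C x \<longrightarrow> cstar_positive (\<psi> x))"

text \<open>The two presentations agree: every instance of the type class yields such a structure.\<close>

definition structure_of :: "'a::unital_cstar_algebra itself \<Rightarrow> 'a cstar_structure"
  where "structure_of _ =
    \<lparr>carrier = UNIV, mult = (*), one = 1, zero = 0, add = (+),
     cscale = scaleC, cstar = star, cnorm = norm\<rparr>"

lemma structure_of_simps [simp]:
  "carrier (structure_of TYPE('a::unital_cstar_algebra)) = UNIV"
  "mult (structure_of TYPE('a)) = (*)"
  "one (structure_of TYPE('a)) = 1"
  "zero (structure_of TYPE('a)) = 0"
  "add (structure_of TYPE('a)) = (+)"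
  "cscale (structure_of TYPE('a)) = scaleC"
  "cstar (structure_of TYPE('a)) = star"
  "cnorm (structure_of TYPE('a)) = norm"
  by (simp_all add: structure_of_def)

lemma ring_structure_of: "ring (structure_of TYPE('a::unital_cstar_algebra))"
proof (rule ringI)
  show "abelian_group (structure_of TYPE('a))"
    by (rule abelian_groupI) (auto simp: algebra_simps intro: exI[of _ "- _"] add.right_inverse)
  show "monoid (structure_of TYPE('a))"
    by (rule monoidI) (auto simp: mult.assoc)
qed (auto simp: algebra_simps)

lemma minus_structure_of:
  "x \<ominus>\<^bsub>structure_of TYPE('a::unital_cstar_algebra)\<^esub> y = x - y"
proof -
  interpret ring "structure_of TYPE('a)" by (rule ring_structure_of)
  have "\<ominus>\<^bsub>structure_of TYPE('a)\<^esub> y = - y"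
    by (rule minus_equality) auto
  then show ?thesis by (simp add: a_minus_def)
qed

lemma unital_cstar_structure_of:
  "unital_cstar_structure (structure_of TYPE('a::unital_cstar_algebra))"
proof (intro unital_cstar_structure.intro ring_structure_of unital_cstar_structure_axioms.intro)
  fix s :: "nat \<Rightarrow> 'a"
  assume "\<And>e. e > 0 \<Longrightarrow> \<exists>N. \<forall>m\<ge>N. \<forall>n\<ge>N. cnorm (structure_of TYPE('a))
    (s m \<ominus>\<^bsub>structure_of TYPE('a)\<^esub> s n) < e"
  then have "Cauchy s" by (simp add: minus_structure_of Cauchy_iff)
  then obtain l where "s \<longlonglongrightarrow> l" using Cauchy_convergent_iff convergent_def by blast
  then have "(\<lambda>n. norm (s n - l)) \<longlonglongrightarrow> 0" by (simp add: LIM_zero tendsto_norm_zero)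
  then show "\<exists>l\<in>carrier (structure_of TYPE('a)).
      (\<lambda>n. cnorm (structure_of TYPE('a)) (s n \<ominus>\<^bsub>structure_of TYPE('a)\<^esub> l)) \<longlonglongrightarrow> 0"
    by (auto simp: minus_structure_of)
next
  fix x :: 'a
  show "cscale (structure_of TYPE('a)) 1 x = x"
    using scaleR_scaleC[of 1 x] by simp
qed (simp_all add: scaleC_add_right scaleC_add_left scaleC_scaleC mult_scaleC_left mult_scaleC_right
      norm_triangle_ineq norm_scaleC norm_mult_ineq star_add star_scaleC star_mult star_star
      cstar_identity)

lemma positive_in_structure_of:
  "positive_in (structure_of TYPE('a::unital_cstar_algebra)) a \<longleftrightarrow> cstar_positive a"
  by (simp add: positive_in_def cstar_positive_def)

end

theory Submission
  imports Defs "HOL-Library.Poly_Mapping"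
begin

text \<open>
  For \<open>(2) \<Longrightarrow> (1)\<close> the double sums are values \<open>\<phi>\<^sub>2 (T\<^sup>* b\<^sup>* b T)\<close> and \<open>\<phi>\<^sub>2 (T\<^sup>* T)\<close> with \<open>b = \<phi>\<^sub>1 a\<close> and
  \<open>T = \<Sum> \<alpha>\<^sub>j \<phi>\<^sub>1 a\<^sub>j\<close>, and \<open>K - b\<^sup>* b\<close> is a square for \<open>K > \<parallel>b\<parallel>\<^sup>2\<close>.

  For \<open>(1) \<Longrightarrow> (2)\<close> extend \<open>\<phi>\<close> linearly to \<open>\<Phi>\<close> on the *-algebra \<open>\<complex>[A]\<close> of the multiplicative monoid of \<open>A\<close>
  and consider the \<open>B\<close>-valued form \<open>\<langle>g, h\<rangle> = \<Phi> (g\<^sup>* h)\<close>. Bounded positivity makes every left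
  multiplication bounded: \<open>\<langle>f g, f g\<rangle> \<le> k\<^sup>2 \<langle>g, g\<rangle>\<close> in the order of \<open>B\<close>. The least such \<open>k\<close> is a
  C*-seminorm, by the inequality \<open>\<langle>g, h\<rangle> + \<langle>h, g\<rangle> \<le> c \<langle>g, g\<rangle> + c\<^sup>-\<^sup>1 \<langle>h, h\<rangle>\<close>, so no states or
  Hilbert spaces are needed. \<open>C\<close> is the completion of \<open>\<complex>[A]\<close>, \<open>\<phi>\<^sub>1\<close> the inclusion of \<open>A\<close>
  and \<open>\<phi>\<^sub>2\<close> the extension of \<open>\<Phi>\<close>, positive because the elements \<open>x\<^sup>* x\<close> of \<open>B\<close> form a closed cone.
  The element that is the limit of \<open>s\<^sub>n\<close> is encoded by the function \<open>\<lambda>a b. lim \<Phi> (a\<^sup>* s\<^sub>n b)\<close>.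
\<close>

section \<open>Elementary facts on C*-algebras and square roots\<close>

lemma complex_vector_module: "module (scaleC :: complex \<Rightarrow> 'a::unital_cstar_algebra \<Rightarrow> 'a)"
proof
  fix x :: 'a
  show "1 *\<^sub>C x = x"
    using scaleR_scaleC[of 1 x] by simp
qed (simp_all add: scaleC_add_right scaleC_add_left scaleC_scaleC)

interpretation scaleC: module "scaleC :: complex \<Rightarrow> 'a::unital_cstar_algebra \<Rightarrow> 'a"
  by (rule complex_vector_module)

lemma star_zero [simp]: "star (0::'a::unital_cstar_algebra) = 0"
  using star_add[of "0::'a" 0] by simp

lemma star_uminus: "star (- x) = - star (x::'a::unital_cstar_algebra)"
  using star_add[of x "- x"] by (simp add: eq_neg_iff_add_eq_0 add.commute)

lemma star_diff: "star (x - y) = star x - star (y::'a::unital_cstar_algebra)"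
  using star_add[of x "- y"] by (simp add: star_uminus)

lemma star_scaleR: "star (r *\<^sub>R x) = r *\<^sub>R star (x::'a::unital_cstar_algebra)"
  by (simp add: scaleR_scaleC star_scaleC)

lemma star_one [simp]: "star (1::'a::unital_cstar_algebra) = 1"
  using star_mult[of "star 1" "1::'a"] by (simp add: star_star)

text \<open>The C*-identity and submultiplicativity bound the square of \<open>norm x\<close> by
  \<open>norm (star x) * norm x\<close>; cancel one factor. Applied to \<open>star x\<close> as
  well, this makes the involution isometric.\<close>

lemma norm_le_norm_star: "norm x \<le> norm (star (x::'a::unital_cstar_algebra))"
proof (cases "x = 0")
  case False
  have "norm x * norm x \<le> norm (star x) * norm x"
    using norm_mult_ineq[of "star x" x] cstar_identity[of x] by (simp add: power2_eq_square)
  with False show ?thesis by simp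
qed simp

lemma norm_star [simp]: "norm (star x) = norm (x::'a::unital_cstar_algebra)"
  using norm_le_norm_star[of x] norm_le_norm_star[of "star x"] by (simp add: star_star)

lemma bounded_linear_star: "bounded_linear (star :: 'a::unital_cstar_algebra \<Rightarrow> 'a)"
  by (rule bounded_linear_intro[where K = 1]) (simp_all add: star_add star_scaleR)

lemma tendsto_star: "(f \<longlongrightarrow> l) F \<Longrightarrow> ((\<lambda>x. star (f x :: 'a::unital_cstar_algebra)) \<longlongrightarrow> star l) F"
  by (rule bounded_linear.tendsto[OF bounded_linear_star])

lemma norm_one_le: "norm (1::'a::unital_cstar_algebra) \<le> 1"
proof -
  have "(norm (1::'a))\<^sup>2 = norm (1::'a)"
    using cstar_identity[of "1::'a"] by simp
  then have "norm (1::'a) = 0 \<or> norm (1::'a) = 1"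
    by (auto simp: power2_eq_square)
  then show ?thesis by auto
qed

lemma norm_scaleR_one_le: "0 \<le> t \<Longrightarrow> norm (t *\<^sub>R (1::'a::unital_cstar_algebra)) \<le> t"
  using mult_left_mono[OF norm_one_le, of t] by simp

lemma norm_selfadjoint_square: "star x = x \<Longrightarrow> norm (x * x) = (norm (x::'a::unital_cstar_algebra))\<^sup>2"
  using cstar_identity[of x] by simp

lemma norm_power_le_one: "norm x \<le> 1 \<Longrightarrow> norm (x ^ n) \<le> 1" for x :: "'a::unital_cstar_algebra"
proof (induction n)
  case (Suc n)
  have "norm (x * x ^ n) \<le> norm x * norm (x ^ n)"
    by (rule norm_mult_ineq)
  also have "\<dots> \<le> 1 * 1"
    using Suc by (intro mult_mono) auto
  finally show ?case by simp
qed (simp add: norm_one_le)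

lemma star_power: "star x = x \<Longrightarrow> star (x ^ n) = x ^ n" for x :: "'a::unital_cstar_algebra"
proof (induction n)
  case (Suc n)
  then show ?case by (simp add: star_mult flip: power_Suc2)
qed simp

section \<open>The binomial series of sqrt (1 - z) and its value at a self-adjoint
  contraction\<close>

text \<open>The Taylor coefficients of \<open>sqrt (1 - z)\<close>.\<close>

definition sqrt_coeff :: "nat \<Rightarrow> real"
  where "sqrt_coeff n = pochhammer (- 1 / 2) n / fact n"

lemma sqrt_coeff_0 [simp]: "sqrt_coeff 0 = 1"
  by (simp add: sqrt_coeff_def)

lemma sqrt_coeff_Suc_le_0: "sqrt_coeff (Suc n) \<le> 0"
proof -
  have "0 \<le> pochhammer (1 / 2 :: real) n"
    by (simp add: pochhammer_prod prod_nonneg)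
  then show ?thesis
    by (simp add: sqrt_coeff_def pochhammer_rec divide_nonpos_pos)
qed

text \<open>Partial sums are the coefficients of sqrt (1 - z) / (1 - z), that is of (1 - z) to the
  power -1/2. This is Vandermonde's identity for the parameters -1/2 and 1, where
  \<open>pochhammer 1 m\<close> is \<open>fact m\<close>.\<close>

lemma sum_sqrt_coeff: "(\<Sum>k\<le>n. sqrt_coeff k) = pochhammer (1 / 2) n / fact n"
proof -
  have "pochhammer (1 / 2 :: real) n
      = (\<Sum>k\<le>n. real (n choose k) * pochhammer (- 1 / 2) k * pochhammer 1 (n - k))"
    using pochhammer_binomial_sum[of "- 1 / 2 :: real" 1 n] by simp
  also have "\<dots> = (\<Sum>k\<le>n. fact n * sqrt_coeff k)"
    by (intro sum.cong) (simp_all add: sqrt_coeff_def binomial_fact pochhammer_fact[symmetric])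
  finally show ?thesis
    by (simp add: sum_distrib_left[symmetric])
qed

text \<open>All coefficients after the first are nonpositive, so the absolute sum is 1 minus a
  partial sum, and partial sums are nonnegative. Hence the series converges absolutely even on the
  boundary of the unit disc.\<close>

lemma sum_abs_sqrt_coeff: "(\<Sum>k<n. \<bar>sqrt_coeff (Suc k)\<bar>) \<le> 1"
proof -
  have "(\<Sum>k<n. \<bar>sqrt_coeff (Suc k)\<bar>) = - (\<Sum>k<n. sqrt_coeff (Suc k))"
    by (simp add: abs_of_nonpos sqrt_coeff_Suc_le_0 sum_negf)
  also have "\<dots> = 1 - (\<Sum>k\<le>n. sqrt_coeff k)"
    by (simp add: sum.atMost_shift)
  also have "\<dots> \<le> 1"
    by (simp add: sum_sqrt_coeff pochhammer_prod prod_nonneg)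
  finally show ?thesis .
qed

lemma summable_abs_sqrt_coeff_Suc: "summable (\<lambda>k. \<bar>sqrt_coeff (Suc k)\<bar>)"
proof (rule bounded_imp_summable[where B = 1])
  show "(\<Sum>k\<le>n. \<bar>sqrt_coeff (Suc k)\<bar>) \<le> 1" for n
    using sum_abs_sqrt_coeff[of "Suc n"] by (simp only: lessThan_Suc_atMost)
qed simp

lemma summable_abs_sqrt_coeff: "summable (\<lambda>k. \<bar>sqrt_coeff k\<bar>)"
  using summable_abs_sqrt_coeff_Suc by (subst (asm) summable_Suc_iff)

lemma suminf_abs_sqrt_coeff_Suc: "suminf (\<lambda>k. \<bar>sqrt_coeff (Suc k)\<bar>) \<le> 1"
  by (rule suminf_le_const[OF summable_abs_sqrt_coeff_Suc sum_abs_sqrt_coeff])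

text \<open>The square of the series is 1 - z: Vandermonde's identity with -1/2 twice gives
  \<open>pochhammer (- 1) n\<close>, which vanishes from n = 2 on.\<close>

lemma sqrt_coeff_convolution:
  "(\<Sum>i\<le>n. sqrt_coeff i * sqrt_coeff (n - i)) = (if n = 0 then 1 else if n = 1 then - 1 else 0)"
proof -
  have "pochhammer (- 1 :: real) n
      = (\<Sum>k\<le>n. real (n choose k) * pochhammer (- 1 / 2) k * pochhammer (- 1 / 2) (n - k))"
    using pochhammer_binomial_sum[of "- 1 / 2 :: real" "- 1 / 2" n] by simp
  also have "\<dots> = (\<Sum>k\<le>n. fact n * (sqrt_coeff k * sqrt_coeff (n - k)))"
    by (intro sum.cong) (simp_all add: sqrt_coeff_def binomial_fact)
  finally have *: "(\<Sum>i\<le>n. sqrt_coeff i * sqrt_coeff (n - i)) = pochhammer (- 1) n / fact n"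
    by (simp add: sum_distrib_left[symmetric])
  show ?thesis
  proof (cases "n \<le> 1")
    case True
    then show ?thesis unfolding * by (cases n) auto
  next
    case False
    then have "pochhammer (- 1 :: real) n = 0"
      using pochhammer_of_nat_eq_0_iff[of 1 n, where 'a = real] by simp
    with False show ?thesis unfolding * by simp
  qed
qed

text \<open>Evaluate the series at \<open>h\<close>; absolute summability of the coefficients covers
  norm exactly 1. The third conclusion makes \<open>s\<close> positive in the sense of
  \<open>psd\<close> below. The commutation clause, obtained by passing to the limit of the powers
  of \<open>h\<close>, is what makes square roots of commuting elements commute.\<close>

lemma sqrt_one_minus:
  fixes h :: "'a::unital_cstar_algebra"
  assumes sa: "star h = h" and le: "norm h \<le> 1"
  obtains s where "star s = s" "s * s = 1 - h" "norm (1 - s) \<le> 1"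
    "\<forall>y. y * h = h * y \<longrightarrow> y * s = s * y"
proof
  let ?f = "\<lambda>n. sqrt_coeff n *\<^sub>R h ^ n"
  define s where "s = suminf ?f"
  have norm_f: "norm (?f n) \<le> \<bar>sqrt_coeff n\<bar>" for n
    using mult_left_mono[OF norm_power_le_one[OF le, of n], of "\<bar>sqrt_coeff n\<bar>"] by simp
  have abs_summable: "summable (\<lambda>n. norm (?f n))"
    by (rule summable_comparison_test'[OF summable_abs_sqrt_coeff, of 0]) (use norm_f in simp)
  then have sums: "?f sums s"
    unfolding s_def by (rule summable_sums[OF summable_norm_cancel])
  have "(\<lambda>n. star (?f n)) sums star s"
    by (rule bounded_linear.sums[OF bounded_linear_star sums])
  then have "?f sums star s"
    by (simp add: star_scaleR star_power[OF sa])
  then show "star s = s"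
    using sums by (rule sums_unique2)
  show "\<forall>y. y * h = h * y \<longrightarrow> y * s = s * y"
  proof (intro allI impI)
    fix y assume "y * h = h * y"
    then have comm: "h ^ n * y = y * h ^ n" for n
      using power_commuting_commutes[of h y n] by simp
    have "(\<lambda>n. ?f n * y) sums (s * y)"
      by (rule bounded_linear.sums[OF bounded_linear_mult_left sums])
    moreover have "?f n * y = y * ?f n" for n
      using comm[of n] by simp
    ultimately have "(\<lambda>n. y * ?f n) sums (s * y)"
      by (simp only:)
    then show "y * s = s * y"
      by (rule sums_unique2[OF bounded_linear.sums[OF bounded_linear_mult_right sums]])
  qed
  have "(\<lambda>n. \<Sum>i\<le>n. ?f i * ?f (n - i)) sums (s * s)"
    using Cauchy_product_sums[OF abs_summable abs_summable] by (simp add: s_def)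
  moreover have "(\<Sum>i\<le>n. ?f i * ?f (n - i))
      = (\<Sum>i\<le>n. sqrt_coeff i * sqrt_coeff (n - i)) *\<^sub>R h ^ n" for n
    unfolding scaleR_left.sum
    by (intro sum.cong) (simp_all add: power_add[symmetric])
  ultimately have "(\<lambda>n. (if n = 0 then 1 else if n = 1 then - 1 else 0) *\<^sub>R h ^ n) sums (s * s)"
    unfolding sqrt_coeff_convolution by simp
  moreover have "(\<lambda>n. (if n = 0 then 1 else if n = 1 then - 1 else 0) *\<^sub>R h ^ n) sums
      (\<Sum>n\<in>{0, 1}. (if n = 0 then 1 else if n = 1 then - 1 else 0) *\<^sub>R h ^ n)"
    by (rule sums_finite) auto
  ultimately have "s * s = (\<Sum>n\<in>{0, 1}. (if n = 0 then 1 else if n = 1 then - 1 else 0) *\<^sub>R h ^ n)"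
    by (rule sums_unique2)
  then show "s * s = 1 - h"
    by simp
  \<comment> \<open>Without the constant term the absolute sum of the coefficients is at most
    1.\<close>
  have s_minus_1: "(\<lambda>n. ?f (Suc n)) sums (s - 1)"
    using sums sums_Suc_iff[of ?f "s - 1"] by simp
  have summable_Suc: "summable (\<lambda>n. norm (?f (Suc n)))"
    using abs_summable by (subst summable_Suc_iff)
  then have "norm (s - 1) \<le> suminf (\<lambda>n. norm (?f (Suc n)))"
    using summable_norm[OF summable_Suc] sums_unique[OF s_minus_1] by simp
  also have "\<dots> \<le> suminf (\<lambda>n. \<bar>sqrt_coeff (Suc n)\<bar>)"
    using norm_f by (intro suminf_le summable_Suc summable_abs_sqrt_coeff_Suc)
  finally show "norm (1 - s) \<le> 1"
    using suminf_abs_sqrt_coeff_Suc by (simp add: norm_minus_commute)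
qed

section \<open>The positive cone\<close>

text \<open>
  For self-adjoint \<open>a\<close> the condition \<open>norm (t - a) \<le> t\<close> confines the spectrum to \<open>[0, 2t]\<close>. It
  makes the convex cone property immediate.
\<close>

definition psd :: "'a::unital_cstar_algebra \<Rightarrow> bool"
  where "psd a \<longleftrightarrow> star a = a \<and> (\<exists>t. norm (t *\<^sub>R 1 - a) \<le> t)"

lemma psd_selfadjoint: "psd a \<Longrightarrow> star a = a"
  by (simp add: psd_def)

lemma psdI: "star a = a \<Longrightarrow> norm (t *\<^sub>R 1 - a) \<le> t \<Longrightarrow> psd a"
  by (auto simp: psd_def)

lemma psd_zero [simp]: "psd 0"
  by (rule psdI[where t = 0]) simp_all

lemma psd_add:
  assumes "psd a" "psd b"
  shows "psd (a + b)"
proof -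
  obtain s t where *: "norm (s *\<^sub>R 1 - a) \<le> s" "norm (t *\<^sub>R 1 - b) \<le> t"
    using assms by (auto simp: psd_def)
  have "(s + t) *\<^sub>R 1 - (a + b) = (s *\<^sub>R 1 - a) + (t *\<^sub>R 1 - b)"
    by (simp add: algebra_simps)
  then have "norm ((s + t) *\<^sub>R 1 - (a + b)) \<le> s + t"
    using norm_triangle_le[of "s *\<^sub>R 1 - a" "t *\<^sub>R 1 - b" "s + t"] * by (simp only:)
  then show ?thesis
    using assms by (intro psdI) (simp_all add: star_add psd_selfadjoint)
qed

lemma psd_scaleR:
  assumes "psd a" "0 \<le> r"
  shows "psd (r *\<^sub>R a)"
proof -
  obtain t where "norm (t *\<^sub>R 1 - a) \<le> t"
    using assms by (auto simp: psd_def)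
  then have "norm ((r * t) *\<^sub>R 1 - r *\<^sub>R a) \<le> r * t"
    using assms(2) mult_left_mono[of "norm (t *\<^sub>R 1 - a)" t r] norm_scaleR[of r "t *\<^sub>R 1 - a"] by (simp add: scaleR_diff_right)
  then show ?thesis
    using assms by (intro psdI) (simp_all add: star_scaleR psd_selfadjoint)
qed

lemma psd_one_minus: "star h = h \<Longrightarrow> norm h \<le> 1 \<Longrightarrow> psd (1 - h)"
  by (rule psdI[where t = 1]) (simp_all add: star_diff)

lemma psd_scaleR_one_minus: "star a = a \<Longrightarrow> norm a \<le> t \<Longrightarrow> psd (t *\<^sub>R 1 - a)"
  by (rule psdI[where t = t]) (simp_all add: star_diff star_scaleR)

text \<open>A witness t > 0 gives \<open>a = t *\<^sub>R (1 - h)\<close> with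
  \<open>norm h \<le> 1\<close>, so the root is sqrt t times the series at \<open>h\<close>.
  Commuting with \<open>a\<close> is the same as commuting with \<open>h\<close>.\<close>

lemma psd_sqrt:
  fixes a :: "'a::unital_cstar_algebra"
  assumes "psd a"
  obtains s where "psd s" "s * s = a" "\<forall>y. y * a = a * y \<longrightarrow> y * s = s * y"
proof -
  obtain t where t: "norm (t *\<^sub>R 1 - a) \<le> t" and sa: "star a = a"
    using assms by (auto simp: psd_def)
  have "0 \<le> t" using t norm_ge_zero order_trans by blast
  show thesis
  proof (cases "t = 0")
    case True
    with t have "a = 0" by simp
    then show ?thesis using that[of 0] by simp
  next
    case False
    with \<open>0 \<le> t\<close> have "0 < t" by simp
    define h where "h = 1 - (1 / t) *\<^sub>R a"
    have "star h = h"
      by (simp add: h_def star_diff star_scaleR sa)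
    have "t *\<^sub>R h = t *\<^sub>R 1 - a"
      using \<open>0 < t\<close> by (simp add: h_def scaleR_diff_right)
    then have "t * norm h \<le> t"
      using t \<open>0 < t\<close> norm_scaleR[of t h] by simp
    then have "norm h \<le> 1"
      using \<open>0 < t\<close> by simp
    obtain s where s: "star s = s" "s * s = 1 - h" "norm (1 - s) \<le> 1"
        "\<forall>y. y * h = h * y \<longrightarrow> y * s = s * y"
      by (rule sqrt_one_minus[OF \<open>star h = h\<close> \<open>norm h \<le> 1\<close>])
    show ?thesis
    proof (rule that[of "sqrt t *\<^sub>R s"])
      have "psd s"
        using s(1,3) by (intro psdI[where t = 1]) simp_all
      then show "psd (sqrt t *\<^sub>R s)"
        using \<open>0 < t\<close> by (intro psd_scaleR) simp_all
      show "sqrt t *\<^sub>R s * sqrt t *\<^sub>R s = a"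
        using \<open>0 < t\<close> s(2) by (simp add: h_def)
      show "\<forall>y. y * a = a * y \<longrightarrow> y * sqrt t *\<^sub>R s = sqrt t *\<^sub>R s * y"
      proof (intro allI impI)
        fix y assume "y * a = a * y"
        then have "y * h = h * y"
          by (simp add: h_def algebra_simps)
        with s(4) have "y * s = s * y"
          by blast
        then show "y * sqrt t *\<^sub>R s = sqrt t *\<^sub>R s * y"
          by simp
      qed
    qed
  qed
qed

text \<open>The element d + i e is sqrt r times an isometry, because \<open>d\<close> and
  \<open>e\<close> commute; hence its norm is at most sqrt r, and \<open>d\<close> is its real part.
  This replaces spectral theory in the norm estimates below.\<close>

lemma norm_le_of_unitary_parts:
  fixes d e :: "'a::unital_cstar_algebra"
  assumes "star d = d" "star e = e" "d * e = e * d" "d * d + e * e = r *\<^sub>R 1" "0 \<le> r"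
  shows "norm (d * d) \<le> r"
proof -
  define v where "v = d + \<i> *\<^sub>C e"
  have star_v: "star v = d - \<i> *\<^sub>C e"
    by (simp add: v_def star_add star_scaleC assms)
  have "star v * v = r *\<^sub>R 1"
    unfolding star_v unfolding v_def
    by (simp add: algebra_simps mult_scaleC_left mult_scaleC_right assms(3) flip: assms(4))
  then have "(norm v)\<^sup>2 \<le> r"
    using norm_scaleR_one_le[OF \<open>0 \<le> r\<close>, where 'a = 'a] cstar_identity[of v] by simp
  have "2 *\<^sub>R d = v + star v"
    by (simp add: star_v) (simp add: v_def scaleR_2)
  then have "2 * norm d \<le> 2 * norm v"
    using norm_triangle_ineq[of v "star v"] norm_scaleR[of 2 d] by simp
  then have "(norm d)\<^sup>2 \<le> (norm v)\<^sup>2"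
    by (intro power_mono) simp_all
  with \<open>(norm v)\<^sup>2 \<le> r\<close> show ?thesis
    using norm_selfadjoint_square[OF assms(1)] by (simp only:)
qed

text \<open>With s the root of 1 - x^2, which commutes with \<open>x\<close>, the element s + i x is
  of the kind treated just before, for r = 1.\<close>

lemma norm_one_minus_square_le:
  fixes x :: "'a::unital_cstar_algebra"
  assumes "star x = x" "norm x \<le> 1"
  shows "norm (1 - x * x) \<le> 1"
proof -
  have le: "norm (x * x) \<le> 1"
    using assms by (simp add: norm_selfadjoint_square power_le_one)
  obtain s where s: "star s = s" "s * s = 1 - x * x"
      "\<forall>y. y * (x * x) = x * x * y \<longrightarrow> y * s = s * y"
    using sqrt_one_minus[OF _ le] assms by (metis star_mult)
  have "norm (s * s) \<le> 1"
    using s(1,2) assms s(3)[rule_format, of x] by (intro norm_le_of_unitary_parts[of s x]) (simp_all add: mult.assoc)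
  then show ?thesis by (simp add: s(2))
qed

lemma psd_square:
  fixes x :: "'a::unital_cstar_algebra"
  assumes "star x = x"
  shows "norm ((norm x)\<^sup>2 *\<^sub>R 1 - x * x) \<le> (norm x)\<^sup>2" "psd (x * x)"
proof -
  show *: "norm ((norm x)\<^sup>2 *\<^sub>R 1 - x * x) \<le> (norm x)\<^sup>2"
  proof (cases "x = 0")
    case False
    define y where "y = (1 / norm x) *\<^sub>R x"
    have "norm (1 - y * y) \<le> 1"
      using False by (intro norm_one_minus_square_le) (simp_all add: y_def star_scaleR assms)
    moreover have "(norm x)\<^sup>2 *\<^sub>R 1 - x * x = (norm x)\<^sup>2 *\<^sub>R (1 - y * y)"
      using False by (simp add: y_def scaleR_diff_right power2_eq_square)
    ultimately show ?thesis
      using mult_left_mono[of "norm (1 - y * y)" 1 "(norm x)\<^sup>2"] by simp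
  qed simp
  then show "psd (x * x)"
    by (rule psdI[rotated]) (simp add: star_mult assms)
qed

text \<open>The witness t in \<open>psd\<close> can always be chosen as \<open>norm a\<close>: write
  \<open>a\<close> as the square of a self-adjoint element and use \<open>psd_square\<close>. A
  witness that depends continuously on \<open>a\<close> is what the closedness of the cone
  requires.\<close>

lemma psd_norm_minus_le:
  assumes "psd a"
  shows "norm (norm a *\<^sub>R 1 - a) \<le> norm a"
proof -
  obtain s where "psd s" "s * s = a"
    using psd_sqrt[OF assms] by metis
  then show ?thesis
    using psd_square(1)[of s] norm_selfadjoint_square[of s] by (simp add: psd_selfadjoint)
qed

lemma psd_norm_minus:
  assumes "psd a"
  shows "psd (norm a *\<^sub>R 1 - a)"
  using assms by (simp add: psd_scaleR_one_minus psd_selfadjoint)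

lemma psd_closed:
  assumes lim: "X \<longlonglongrightarrow> a" and psd: "\<And>n. psd (X n)"
  shows "psd a"
proof (rule psdI)
  have "(\<lambda>n. star (X n)) \<longlonglongrightarrow> star a"
    by (rule tendsto_star[OF lim])
  then show "star a = a"
    using lim psd by (intro LIMSEQ_unique[of X]) (simp_all add: psd_selfadjoint)
  show "norm (norm a *\<^sub>R 1 - a) \<le> norm a"
  proof (rule LIMSEQ_le)
    show "(\<lambda>n. norm (norm (X n) *\<^sub>R 1 - X n)) \<longlonglongrightarrow> norm (norm a *\<^sub>R 1 - a)"
      by (intro tendsto_intros lim)
    show "(\<lambda>n. norm (X n)) \<longlonglongrightarrow> norm a"
      by (intro tendsto_intros lim)
  qed (use psd_norm_minus_le[OF psd] in blast)
qed

text \<open>The roots \<open>d\<close> of u and \<open>e\<close> of r - u commute and satisfy d^2 +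
  e^2 = r, so \<open>norm_le_of_unitary_parts\<close> applies.\<close>

lemma psd_norm_le:
  fixes u :: "'a::unital_cstar_algebra"
  assumes u: "psd u" and w: "psd (r *\<^sub>R 1 - u)" and "0 \<le> r"
  shows "norm u \<le> r"
proof -
  obtain d where d: "psd d" "d * d = u" "\<forall>y. y * u = u * y \<longrightarrow> y * d = d * y"
    by (rule psd_sqrt[OF u])
  obtain e where e: "psd e" "e * e = r *\<^sub>R 1 - u"
      "\<forall>y. y * (r *\<^sub>R 1 - u) = (r *\<^sub>R 1 - u) * y \<longrightarrow> y * e = e * y"
    by (rule psd_sqrt[OF w])
  have "d * u = u * d"
    by (simp add: mult.assoc flip: d(2))
  then have "d * e = e * d"
    by (intro e(3)[rule_format]) (simp add: algebra_simps)
  then show ?thesis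
    using norm_le_of_unitary_parts[of d e r] d(1,2) e(1,2) \<open>0 \<le> r\<close> by (simp add: psd_selfadjoint)
qed

lemma psd_norm_mono:
  assumes "psd u" "psd (v - u)"
  shows "norm u \<le> norm v"
proof (rule psd_norm_le[OF \<open>psd u\<close>])
  have "psd v" using psd_add[OF assms] by simp
  then show "psd (norm v *\<^sub>R 1 - u)"
    using psd_add[OF psd_norm_minus[OF \<open>psd v\<close>] assms(2)] by simp
qed simp

text \<open>The roots of \<open>a\<close> and \<open>b\<close> commute: first the root of
  \<open>a\<close> commutes with \<open>b\<close>, then the root of \<open>b\<close> commutes with
  the root of \<open>a\<close>. The product is therefore the square of the self-adjoint element
  \<open>d * e\<close>.\<close>

lemma psd_mult_commute:
  assumes "psd a" "psd b" "a * b = b * a"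
  shows "psd (a * b)"
proof -
  obtain d where d: "psd d" "d * d = a" "\<forall>y. y * a = a * y \<longrightarrow> y * d = d * y"
    by (rule psd_sqrt[OF \<open>psd a\<close>])
  obtain e where e: "psd e" "e * e = b" "\<forall>y. y * b = b * y \<longrightarrow> y * e = e * y"
    by (rule psd_sqrt[OF \<open>psd b\<close>])
  have de: "d * e = e * d"
    using d(3)[rule_format, of b] e(3)[rule_format, of d] assms(3) by simp
  have "psd ((d * e) * (d * e))"
    using d(1) e(1) de by (intro psd_square) (simp add: star_mult psd_selfadjoint)
  also have "(d * e) * (d * e) = d * (e * d) * e"
    by (simp add: mult.assoc)
  also have "\<dots> = a * b"
    unfolding de[symmetric] by (simp add: mult.assoc flip: d(2) e(2))
  finally show ?thesis .
qed

section \<open>Positivity of star x * x\<close>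

lemma psd_star_mult_add_mult_star:
  fixes y :: "'a::unital_cstar_algebra"
  shows "psd (star y * y + y * star y)"
proof -
  \<comment> \<open>Twice the real part of \<open>y\<close> and minus twice its imaginary part. In
    the sum of their squares the terms \<open>y * y\<close> and \<open>star y * star y\<close>
    cancel.\<close>
  define p where "p = y + star y"
  define q where "q = \<i> *\<^sub>C (y - star y)"
  have "psd (p * p)" "psd (q * q)"
    by (intro psd_square; simp add: p_def q_def star_add star_diff star_scaleC star_star
          scaleC.scale_right_diff_distrib add.commute)+
  then have "psd ((1 / 2) *\<^sub>R (p * p + q * q))"
    by (intro psd_scaleR psd_add) simp_all
  also have "p * p + q * q = 2 *\<^sub>R (star y * y + y * star y)"
    by (simp add: p_def q_def mult_scaleC_left mult_scaleC_right scaleC_scaleC scaleR_2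
          algebra_simps)
  finally show ?thesis by simp
qed

text \<open>
  With \<open>b = - star y * y\<close> and \<open>c = y * star y\<close>, both positive and of norm 1 after scaling,
  \<open>c + c\<^sup>2 = y * (1 - b) * star y\<close> has norm at most 1, whereas positivity of \<open>c\<close> would force
  its norm to be 2.
\<close>

lemma psd_neg_star_mult_self_normalized:
  fixes y :: "'a::unital_cstar_algebra"
  assumes neg: "psd (- (star y * y))" and one: "norm y = 1"
  shows False
proof -
  define b c where "b = - (star y * y)" and "c = y * star y"
  have "psd b" using neg by (simp add: b_def)
  have "psd c"
    using psd_add[OF psd_star_mult_add_mult_star[of y] neg] by (simp add: c_def)
  have "norm b = 1" "norm c = 1"
    using cstar_identity[of y] cstar_identity[of "star y"] one by (simp_all add: b_def c_def star_star)
  then have "norm (1 - b) \<le> 1"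
    using psd_norm_minus_le[OF \<open>psd b\<close>] by simp
  have "c + c * c = y * (1 - b) * star y"
    by (simp add: b_def c_def algebra_simps mult.assoc)
  then have "norm (c + c * c) \<le> norm (y * (1 - b)) * norm (star y)"
    using norm_mult_ineq[of "y * (1 - b)" "star y"] by simp
  also have "\<dots> \<le> 1"
    using norm_mult_ineq[of y "1 - b"] \<open>norm (1 - b) \<le> 1\<close> one by simp
  finally have "psd (1 - (c + c * c))"
    using \<open>psd c\<close> by (intro psd_one_minus) (simp_all add: star_add star_mult psd_selfadjoint)
  \<comment> \<open>Adding this to the previous fact cancels the linear term and leaves 1 - 2 c^2
    positive, so c^2 has norm at most 1/2 although \<open>c\<close> has norm 1.\<close>
  moreover have "psd (c * (1 - c))"
    using psd_norm_minus[OF \<open>psd c\<close>] \<open>norm c = 1\<close> \<open>psd c\<close>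
    by (intro psd_mult_commute) (simp_all add: algebra_simps)
  ultimately have "psd (1 - (c + c * c) + c * (1 - c))"
    by (rule psd_add)
  moreover have "1 - (c + c * c) + c * (1 - c) = 1 *\<^sub>R 1 - 2 *\<^sub>R (c * c)"
    by (simp add: algebra_simps scaleR_2)
  ultimately have "norm (2 *\<^sub>R (c * c)) \<le> 1"
    using psd_square(2)[of c] \<open>psd c\<close>
    by (intro psd_norm_le psd_scaleR) (simp_all add: psd_selfadjoint)
  then show False
    using norm_selfadjoint_square[of c] \<open>psd c\<close> \<open>norm c = 1\<close> by (simp add: psd_selfadjoint)
qed

lemma psd_neg_star_mult_self:
  fixes y :: "'a::unital_cstar_algebra"
  assumes "psd (- (star y * y))"
  shows "y = 0"
proof (rule ccontr)
  assume "y \<noteq> 0"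
  define z where "z = (1 / norm y) *\<^sub>R y"
  have "- (star z * z) = (1 / (norm y)\<^sup>2) *\<^sub>R (- (star y * y))"
    by (simp add: z_def star_scaleR power2_eq_square)
  then have "psd (- (star z * z))"
    using psd_scaleR[OF assms, of "1 / (norm y)\<^sup>2"] by simp
  moreover have "norm z = 1"
    using \<open>y \<noteq> 0\<close> by (simp add: z_def)
  ultimately show False
    by (rule psd_neg_star_mult_self_normalized)
qed

text \<open>With \<open>a = star x * x\<close> and \<open>m = \<bar>a\<bar> - a\<close>, the element \<open>star (x * m) * (x * m)\<close> is \<open>- m\<bar>a\<bar>m\<close>.\<close>

lemma psd_star_mult_self:
  fixes x :: "'a::unital_cstar_algebra"
  shows "psd (star x * x)"
proof -
  define a where "a = star x * x"
  have a_sa: "star a = a"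
    by (simp add: a_def star_mult star_star)
  \<comment> \<open>\<open>b\<close> is the absolute value of \<open>a\<close>. It commutes with
    everything that commutes with \<open>a * a\<close>, in particular with \<open>a\<close>.\<close>
  obtain b where b: "psd b" "b * b = a * a" "\<forall>y. y * (a * a) = a * a * y \<longrightarrow> y * b = b * y"
    by (rule psd_sqrt[OF psd_square(2)[OF a_sa]])
  have ab: "a * b = b * a"
    by (rule b(3)[rule_format]) (simp add: mult.assoc)
  define m where "m = b - a"
  have m_sa: "star m = m"
    using b(1) a_sa by (simp add: m_def star_diff psd_selfadjoint)
  have am: "a * m = - (b * m)"
    by (simp add: m_def algebra_simps b(2) ab)
  have bm: "b * m = m * b"
    by (simp add: m_def algebra_simps ab)
  \<comment> \<open>The root of the absolute value turns \<open>m * (b * m)\<close> into the square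
    of the self-adjoint \<open>s * m\<close>, because \<open>s\<close> commutes with
    \<open>m\<close>.\<close>
  obtain s where s: "psd s" "s * s = b" "\<forall>y. y * b = b * y \<longrightarrow> y * s = s * y"
    by (rule psd_sqrt[OF b(1)])
  have sm: "m * s = s * m"
    by (rule s(3)[rule_format]) (simp add: bm)
  have eq: "(s * m) * (s * m) = m * (b * m)"
    using sm by (metis mult.assoc s(2))
  have "star (x * m) * (x * m) = m * (a * m)"
    by (simp add: star_mult m_sa a_def mult.assoc)
  also have "\<dots> = - ((s * m) * (s * m))"
    by (simp add: am eq)
  finally have y: "star (x * m) * (x * m) = - ((s * m) * (s * m))" .
  have "psd ((s * m) * (s * m))"
    using s(1) sm m_sa by (intro psd_square) (simp add: star_mult psd_selfadjoint)
  with y have "x * m = 0"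
    by (intro psd_neg_star_mult_self) simp
  \<comment> \<open>Now both \<open>a * m\<close> and \<open>b * m\<close> vanish, hence so does
    m^2; thus \<open>m = 0\<close> and \<open>a\<close> equals its absolute value.\<close>
  then have "a * m = 0"
    by (simp add: a_def mult.assoc)
  with am have "m * m = 0"
    by (simp add: m_def[of] left_diff_distrib)
  then have "norm m = 0"
    using norm_selfadjoint_square[OF m_sa] by simp
  with b(1) show ?thesis
    by (simp add: m_def a_def)
qed

lemma cstar_positive_iff_psd: "cstar_positive a \<longleftrightarrow> psd a"
proof
  assume "psd a"
  then obtain s where "psd s" "s * s = a"
    by (metis psd_sqrt)
  then show "cstar_positive a"
    by (metis cstar_positive_def psd_selfadjoint)
qed (auto simp: cstar_positive_def psd_star_mult_self)

section \<open>C*-algebras on a carrier set\<close>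

context unital_cstar_structure
begin

lemma cscale_zero: "x \<in> carrier C \<Longrightarrow> cscale C 0 x = \<zero>"
  using cnorm_cscale[of x 0] cnorm_eq_0_iff[of "cscale C 0 x"] by (simp add: cscale_closed)

lemma a_inv_eq_cscale: "x \<in> carrier C \<Longrightarrow> \<ominus> x = cscale C (- 1) x"
  using cscale_add_left[of x "- 1" 1]
  by (intro minus_equality) (simp_all add: cscale_closed cscale_zero cscale_one)

lemma cnorm_zero: "cnorm C \<zero> = 0"
  by (simp add: cnorm_eq_0_iff)

lemma cnorm_a_inv: "x \<in> carrier C \<Longrightarrow> cnorm C (\<ominus> x) = cnorm C x"
  by (simp add: a_inv_eq_cscale cnorm_cscale)

lemma cnorm_minus_commute: "x \<in> carrier C \<Longrightarrow> y \<in> carrier C \<Longrightarrow> cnorm C (x \<ominus> y) = cnorm C (y \<ominus> x)"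
  using cnorm_a_inv[of "x \<ominus> y"] by (simp add: minus_eq minus_add a_comm)

lemma diff_add_diff:
  "x \<in> carrier C \<Longrightarrow> y \<in> carrier C \<Longrightarrow> z \<in> carrier C \<Longrightarrow> (x \<ominus> y) \<oplus> (y \<ominus> z) = x \<ominus> z"
  by (simp add: minus_eq a_assoc r_neg1)

lemma cnorm_diff_triangle:
  "x \<in> carrier C \<Longrightarrow> y \<in> carrier C \<Longrightarrow> z \<in> carrier C \<Longrightarrow>
    cnorm C (x \<ominus> z) \<le> cnorm C (x \<ominus> y) + cnorm C (y \<ominus> z)"
  using cnorm_add[of "x \<ominus> y" "y \<ominus> z"] by (simp add: diff_add_diff)

lemma cstar_zero: "cstar C \<zero> = \<zero>"
  using cstar_cscale[of \<zero> 0] by (simp add: cscale_zero cstar_closed)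

lemma cstar_one: "cstar C \<one> = \<one>"
  using cstar_mult[of "cstar C \<one>" \<one>] by (simp add: cstar_closed cstar_cstar)

lemma cstar_minus:
  "x \<in> carrier C \<Longrightarrow> y \<in> carrier C \<Longrightarrow> cstar C (x \<ominus> y) = cstar C x \<ominus> cstar C y"
  by (simp add: minus_eq a_inv_eq_cscale cstar_add cstar_cscale cscale_closed cstar_closed)

lemma cscale_minus:
  "x \<in> carrier C \<Longrightarrow> y \<in> carrier C \<Longrightarrow> cscale C c (x \<ominus> y) = cscale C c x \<ominus> cscale C c y"
  by (simp add: minus_eq a_inv_eq_cscale cscale_add_right cscale_closed cscale_cscale mult.commute)

lemma cnorm_cstar_le: "x \<in> carrier C \<Longrightarrow> cnorm C x \<le> cnorm C (cstar C x)"
  using cnorm_mult[of "cstar C x" x] cnorm_cstar_mult[of x] cnorm_nonneg[of x]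
    cnorm_nonneg[of "cstar C x"]
  by (cases "cnorm C x = 0") (simp_all add: cstar_closed power2_eq_square)

lemma cnorm_cstar: "x \<in> carrier C \<Longrightarrow> cnorm C (cstar C x) = cnorm C x"
  using cnorm_cstar_le[of x] cnorm_cstar_le[of "cstar C x"] by (simp add: cstar_closed cstar_cstar)

lemma square_diff:
  assumes "x \<in> carrier C" "y \<in> carrier C"
  shows "x \<otimes> x \<ominus> y \<otimes> y = (x \<ominus> y) \<otimes> x \<oplus> y \<otimes> (x \<ominus> y)"
  using assms by (simp add: minus_eq l_distr r_distr l_minus r_minus a_assoc r_neg1)

lemma cnorm_square_diff_le:
  assumes "x \<in> carrier C" "y \<in> carrier C"
  shows "cnorm C (x \<otimes> x \<ominus> y \<otimes> y) \<le> (cnorm C x + cnorm C y) * cnorm C (x \<ominus> y)"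
  using cnorm_add[of "(x \<ominus> y) \<otimes> x" "y \<otimes> (x \<ominus> y)"] cnorm_mult[of "x \<ominus> y" x]
    cnorm_mult[of y "x \<ominus> y"] assms
  by (simp add: square_diff algebra_simps)

text \<open>Limits in the carrier are known only through null sequences of distances; this is how
  two of them are identified.\<close>

lemma cnorm_diff_zeroI:
  assumes "x \<in> carrier C" "y \<in> carrier C" "f \<longlonglongrightarrow> 0" "\<And>n::nat. cnorm C (x \<ominus> y) \<le> f n"
  shows "x = y"
proof -
  have "cnorm C (x \<ominus> y) \<le> 0"
    using assms(3,4) by (intro LIMSEQ_le_const) auto
  then have "x \<ominus> y = \<zero>"
    using assms(1,2) cnorm_nonneg[of "x \<ominus> y"] cnorm_eq_0_iff[of "x \<ominus> y"] by simp
  then have "(x \<ominus> y) \<oplus> y = \<zero> \<oplus> y" by simp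
  then show ?thesis using assms(1,2) by (simp add: minus_eq a_assoc l_neg)
qed

section \<open>Square roots in a carrier structure, by iteration\<close>

text \<open>The iteration \<open>y \<mapsto> (h + y\<^sup>2) / 2\<close> contracts the ball of radius \<open>norm h\<close>; its fixed point is \<open>1 - sqrt (1 - h)\<close>.\<close>

primrec sqrt_iterate :: "'c \<Rightarrow> nat \<Rightarrow> 'c"
  where "sqrt_iterate h 0 = \<zero>"
  | "sqrt_iterate h (Suc n) = cscale C (1 / 2) (h \<oplus> sqrt_iterate h n \<otimes> sqrt_iterate h n)"

lemma sqrt_iterate_closed: "h \<in> carrier C \<Longrightarrow> sqrt_iterate h n \<in> carrier C"
  by (induction n) (simp_all add: cscale_closed)

lemma cstar_sqrt_iterate:
  "h \<in> carrier C \<Longrightarrow> cstar C h = h \<Longrightarrow> cstar C (sqrt_iterate h n) = sqrt_iterate h n"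
  by (induction n)
    (simp_all add: cstar_zero cstar_cscale cstar_add cstar_mult sqrt_iterate_closed)

lemma cnorm_sqrt_step_diff:
  assumes "h \<in> carrier C" "x \<in> carrier C" "y \<in> carrier C"
  shows "cnorm C (cscale C (1 / 2) (h \<oplus> x \<otimes> x) \<ominus> cscale C (1 / 2) (h \<oplus> y \<otimes> y))
    \<le> (cnorm C x + cnorm C y) / 2 * cnorm C (x \<ominus> y)"
proof -
  have "(h \<oplus> x \<otimes> x) \<ominus> (h \<oplus> y \<otimes> y) = x \<otimes> x \<ominus> y \<otimes> y"
    using assms by (simp add: minus_eq minus_add a_ac r_neg1 r_neg2)
  then have "cscale C (1 / 2) (h \<oplus> x \<otimes> x) \<ominus> cscale C (1 / 2) (h \<oplus> y \<otimes> y)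
      = cscale C (1 / 2) (x \<otimes> x \<ominus> y \<otimes> y)"
    using assms by (simp flip: cscale_minus)
  then show ?thesis
    using assms cnorm_square_diff_le[of x y] by (simp add: cnorm_cscale)
qed

text \<open>The ball of radius r = \<open>cnorm C h\<close> is invariant because (r + r^2) / 2 is at
  most r when r is at most 1.\<close>

lemma cnorm_sqrt_iterate:
  assumes "h \<in> carrier C" "cnorm C h \<le> 1"
  shows "cnorm C (sqrt_iterate h n) \<le> cnorm C h"
proof (induction n)
  case (Suc n)
  let ?y = "sqrt_iterate h n"
  have y: "?y \<in> carrier C"
    using assms(1) by (rule sqrt_iterate_closed)
  have "cnorm C (?y \<otimes> ?y) \<le> cnorm C ?y * cnorm C ?y"
    using y y by (rule cnorm_mult)
  also have "\<dots> \<le> cnorm C h * 1"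
    using Suc assms y cnorm_nonneg by (intro mult_mono) auto
  finally have "cnorm C (h \<oplus> ?y \<otimes> ?y) \<le> 2 * cnorm C h"
    using cnorm_add[of h "?y \<otimes> ?y"] assms y by simp
  then show ?case
    using assms y by (simp add: cnorm_cscale)
qed (use assms in \<open>simp add: cnorm_zero cnorm_nonneg\<close>)

text \<open>On the ball of radius r = \<open>cnorm C h\<close> the iteration contracts distances by
  the factor r, which is less than 1 by the strict hypothesis. The limit \<open>l\<close> satisfies
  2 l = h + l^2, which says that 1 - l is a square root of 1 - h.\<close>

lemma sqrt_one_minus_exists:
  assumes h: "h \<in> carrier C" "cstar C h = h" and less: "cnorm C h < 1"
  shows "\<exists>s\<in>carrier C. cstar C s = s \<and> s \<otimes> s = \<one> \<ominus> h"
proof -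
  let ?y = "sqrt_iterate h" and ?r = "cnorm C h"
  have r: "0 \<le> ?r" "?r < 1"
    using h less by (simp_all add: cnorm_nonneg)
  have y: "?y n \<in> carrier C" for n
    using h by (simp add: sqrt_iterate_closed)
  have y_le: "cnorm C (?y n) \<le> ?r" for n
    using h r by (simp add: cnorm_sqrt_iterate)
  have step: "cnorm C (?y (Suc n) \<ominus> ?y n) \<le> ?r ^ n" for n
  proof (induction n)
    case 0
    then show ?case
      using y_le[of 1] y[of 1] r by (simp add: minus_eq)
  next
    case (Suc n)
    have "cnorm C (?y (Suc (Suc n)) \<ominus> ?y (Suc n))
        \<le> (cnorm C (?y (Suc n)) + cnorm C (?y n)) / 2 * cnorm C (?y (Suc n) \<ominus> ?y n)"
      using cnorm_sqrt_step_diff[OF h(1) y y, of "Suc n" n] by simp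
    also have "\<dots> \<le> ?r * ?r ^ n"
    proof (rule mult_mono)
      show "(cnorm C (?y (Suc n)) + cnorm C (?y n)) / 2 \<le> ?r"
        using y_le[of "Suc n"] y_le[of n] by (simp del: sqrt_iterate.simps)
      show "0 \<le> cnorm C (?y (Suc n) \<ominus> ?y n)"
        using y[of n] y[of "Suc n"] by (simp add: cnorm_nonneg del: sqrt_iterate.simps)
    qed (use Suc r in simp_all)
    finally show ?case by simp
  qed
  \<comment> \<open>The partial geometric sum of the step bounds, multiplied by 1 - r so that the
    induction is free of division.\<close>
  have tail: "(1 - ?r) * cnorm C (?y (n + k) \<ominus> ?y n) \<le> ?r ^ n * (1 - ?r ^ k)" for n k
  proof (induction k)
    case 0
    then show ?case
      using y[of n] by (simp add: minus_eq r_neg cnorm_zero)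
  next
    case (Suc k)
    have "cnorm C (?y (n + Suc k) \<ominus> ?y n)
        \<le> ?r ^ (n + k) + cnorm C (?y (n + k) \<ominus> ?y n)"
      using cnorm_diff_triangle[OF y[of "Suc (n + k)"] y[of "n + k"] y[of n]] step[of "n + k"]
      by simp
    then have "(1 - ?r) * cnorm C (?y (n + Suc k) \<ominus> ?y n)
        \<le> (1 - ?r) * (?r ^ (n + k) + cnorm C (?y (n + k) \<ominus> ?y n))"
      using r by (intro mult_left_mono) auto
    also have "\<dots> \<le> (1 - ?r) * ?r ^ (n + k) + ?r ^ n * (1 - ?r ^ k)"
      using Suc by (simp only: distrib_left)
    also have "\<dots> = ?r ^ n * (1 - ?r ^ Suc k)"
      by (simp add: algebra_simps power_add)
    finally show ?case .
  qed
  have tail_le: "cnorm C (?y m \<ominus> ?y n) \<le> ?r ^ n / (1 - ?r)" if "n \<le> m" for m n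
  proof -
    have "?r ^ n * (1 - ?r ^ (m - n)) \<le> ?r ^ n * 1"
      using r by (intro mult_left_mono) auto
    then have "(1 - ?r) * cnorm C (?y m \<ominus> ?y n) \<le> ?r ^ n"
      using tail[of n "m - n"] that by simp
    then show ?thesis
      using r by (simp add: pos_le_divide_eq mult.commute)
  qed
  have "\<exists>N. \<forall>m\<ge>N. \<forall>n\<ge>N. cnorm C (?y m \<ominus> ?y n) < e" if "e > 0" for e
  proof -
    have "(\<lambda>n. ?r ^ n / (1 - ?r)) \<longlonglongrightarrow> 0 / (1 - ?r)"
      using r by (intro tendsto_intros LIMSEQ_power_zero) auto
    then have "eventually (\<lambda>n. ?r ^ n / (1 - ?r) < e) sequentially"
      using that by (intro order_tendstoD) auto
    then obtain N where N: "\<And>n. n \<ge> N \<Longrightarrow> ?r ^ n / (1 - ?r) < e"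
      by (auto simp: eventually_sequentially)
    have "cnorm C (?y m \<ominus> ?y n) < e" if "m \<ge> N" "n \<ge> N" for m n
    proof (cases "n \<le> m")
      case True
      then show ?thesis using tail_le[of n m] N[OF that(2)] by simp
    next
      case False
      then show ?thesis
        using tail_le[of m n] N[OF that(1)] cnorm_minus_commute[OF y y, of m n] by simp
    qed
    then show ?thesis by blast
  qed
  from complete[OF y this] obtain l where l: "l \<in> carrier C" and lim: "(\<lambda>n. cnorm C (?y n \<ominus> l)) \<longlonglongrightarrow> 0"
    by auto
  have sa: "cstar C l = l"
  proof (rule cnorm_diff_zeroI)
    have "cnorm C (cstar C l \<ominus> l) \<le> cnorm C (?y n \<ominus> l) + cnorm C (?y n \<ominus> l)" for n
    proof -
      have "cnorm C (cstar C l \<ominus> ?y n) = cnorm C (?y n \<ominus> l)"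
        using cnorm_cstar[of "l \<ominus> ?y n"] l y h
        by (simp add: cstar_minus cstar_sqrt_iterate cnorm_minus_commute)
      then show ?thesis
        using cnorm_diff_triangle[of "cstar C l" "?y n" l] l y by (simp add: cstar_closed)
    qed
    then show "cnorm C (cstar C l \<ominus> l) \<le> cnorm C (?y n \<ominus> l) + cnorm C (?y n \<ominus> l)" for n .
    show "(\<lambda>n. cnorm C (?y n \<ominus> l) + cnorm C (?y n \<ominus> l)) \<longlonglongrightarrow> 0"
      using tendsto_add[OF lim lim] by simp
  qed (use l in \<open>simp_all add: cstar_closed\<close>)
  have fixed: "cscale C (1 / 2) (h \<oplus> l \<otimes> l) = l"
  proof (rule cnorm_diff_zeroI)
    let ?f = "\<lambda>n. (cnorm C l + ?r) / 2 * cnorm C (?y n \<ominus> l) + cnorm C (?y (Suc n) \<ominus> l)"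
    have "(\<lambda>n. cnorm C (?y (Suc n) \<ominus> l)) \<longlonglongrightarrow> 0"
      by (rule LIMSEQ_Suc[OF lim])
    from tendsto_add[OF tendsto_mult_right_zero[OF lim] this]
    show "?f \<longlonglongrightarrow> 0"
      by (simp only: add_0)
    show "cnorm C (cscale C (1 / 2) (h \<oplus> l \<otimes> l) \<ominus> l) \<le> ?f n" for n
    proof -
      have "cnorm C (cscale C (1 / 2) (h \<oplus> l \<otimes> l) \<ominus> ?y (Suc n))
          \<le> (cnorm C l + cnorm C (?y n)) / 2 * cnorm C (l \<ominus> ?y n)"
        using cnorm_sqrt_step_diff[OF h(1) l y] by simp
      also have "\<dots> \<le> (cnorm C l + ?r) / 2 * cnorm C (?y n \<ominus> l)"
        using y_le[of n] l y h
        by (intro mult_mono) (auto simp: cnorm_minus_commute r intro!: cnorm_nonneg add_nonneg_nonneg)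
      finally show ?thesis
        using cnorm_diff_triangle[of "cscale C (1 / 2) (h \<oplus> l \<otimes> l)" "?y (Suc n)" l] l y[of n] y[of "Suc n"] h
        by (simp add: cscale_closed)
    qed
  qed (use l h in \<open>simp_all add: cscale_closed\<close>)
  have "cscale C 2 l = h \<oplus> l \<otimes> l"
    using cscale_cscale[of "h \<oplus> l \<otimes> l" 2 "1 / 2"] fixed h l by (simp add: cscale_one)
  moreover have "cscale C 2 l = l \<oplus> l"
    using cscale_add_left[of l 1 1] l by (simp add: cscale_one)
  ultimately have ll: "l \<oplus> l = h \<oplus> l \<otimes> l"
    by simp
  have "(\<one> \<ominus> l) \<otimes> (\<one> \<ominus> l) = \<one> \<ominus> (l \<oplus> l) \<oplus> l \<otimes> l"
    using l by (simp add: minus_eq l_distr r_distr l_minus r_minus minus_add a_ac)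
  also have "\<dots> = \<one> \<ominus> h"
    unfolding ll using l h by (simp add: minus_eq minus_add a_assoc l_neg)
  finally show ?thesis
    using l sa by (intro bexI[of _ "\<one> \<ominus> l"]) (simp_all add: cstar_minus cstar_one)
qed

text \<open>Divide by K = \<open>(cnorm C b)\<^sup>2 + 1\<close>: the summand 1 keeps K positive
  when b is zero and makes the norm of b* b / K strictly less than 1, as the iteration
  requires.\<close>

lemma cscale_one_minus_square:
  assumes b: "b \<in> carrier C"
  shows "\<exists>s\<in>carrier C. cstar C s \<otimes> s = cscale C (complex_of_real ((cnorm C b)\<^sup>2 + 1)) \<one> \<ominus> cstar C b \<otimes> b"
proof -
  define K where "K = (cnorm C b)\<^sup>2 + 1"
  have "K > 0" by (simp add: K_def add_nonneg_pos)
  define h where "h = cscale C (complex_of_real (1 / K)) (cstar C b \<otimes> b)"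
  have bb: "cstar C b \<otimes> b \<in> carrier C"
    using b by (simp add: cstar_closed)
  have "cnorm C h = (cnorm C b)\<^sup>2 / K"
    using bb b \<open>K > 0\<close> by (simp add: h_def cnorm_cscale cnorm_cstar_mult norm_divide)
  then have "cnorm C h < 1"
    using \<open>K > 0\<close> by (simp add: K_def divide_less_eq)
  moreover have "cstar C h = h"
    using bb b by (simp add: h_def cstar_cscale cstar_mult cstar_closed cstar_cstar)
  moreover have h: "h \<in> carrier C"
    using bb by (simp add: h_def cscale_closed)
  ultimately obtain s where s: "s \<in> carrier C" "cstar C s = s" "s \<otimes> s = \<one> \<ominus> h"
    using sqrt_one_minus_exists by blast
  define t where "t = cscale C (complex_of_real (sqrt K)) s"
  have "cstar C t \<otimes> t = cscale C (complex_of_real K) (s \<otimes> s)"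
    using s(1,2) \<open>K > 0\<close>
    by (simp add: t_def cstar_cscale mult_cscale_left mult_cscale_right cscale_closed cscale_cscale
        flip: of_real_mult)
  also have "\<dots> = cscale C (complex_of_real K) \<one> \<ominus> cscale C (complex_of_real K) h"
    using h by (simp add: s(3) cscale_minus)
  also have "cscale C (complex_of_real K) h = cstar C b \<otimes> b"
    using bb \<open>K > 0\<close> by (simp add: h_def cscale_cscale cscale_one)
  finally show ?thesis
    using s(1) by (intro bexI[of _ t]) (simp_all add: t_def cscale_closed K_def)
qed

text \<open>Multiplying the hypothesis by \<open>cstar C T\<close> on the left and by
  \<open>T\<close> on the right exhibits the difference of the two Gram elements as a square, so a
  positive map respects the inequality.\<close>

lemma square_sandwich:
  assumes "T \<in> carrier C" "b \<in> carrier C" "s \<in> carrier C"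
    and "cstar C s \<otimes> s = cscale C k \<one> \<ominus> cstar C b \<otimes> b"
  shows "cstar C (s \<otimes> T) \<otimes> (s \<otimes> T)
    = cscale C k (cstar C T \<otimes> T) \<ominus> cstar C (b \<otimes> T) \<otimes> (b \<otimes> T)"
proof -
  have "cstar C (s \<otimes> T) \<otimes> (s \<otimes> T) = cstar C T \<otimes> (cstar C s \<otimes> s) \<otimes> T"
    using assms(1-3) by (simp add: cstar_mult cstar_closed m_assoc)
  also have "\<dots> = cscale C k (cstar C T \<otimes> T) \<ominus> cstar C T \<otimes> (cstar C b \<otimes> b) \<otimes> T"
    using assms by (simp add: cstar_closed cscale_closed minus_eq l_distr r_distr l_minus r_minus
        mult_cscale_left mult_cscale_right)
  finally show ?thesis
    using assms by (simp add: cstar_mult cstar_closed m_assoc)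
qed

end

section \<open>From a factorization to bounded positivity\<close>

lemma (in unital_cstar_structure) boundedly_positive_type_comp:
  fixes \<phi>\<^sub>1 :: "'a::unital_cstar_algebra \<Rightarrow> 'c" and \<phi>\<^sub>2 :: "'c \<Rightarrow> 'b::unital_cstar_algebra"
  assumes mult: "star_multiplicative_into C \<phi>\<^sub>1" and pos: "positive_linear_from C \<phi>\<^sub>2"
  shows "boundedly_positive_type (\<phi>\<^sub>2 \<circ> \<phi>\<^sub>1)"
proof -
  have \<phi>1: "\<phi>\<^sub>1 a \<in> carrier C" "\<phi>\<^sub>1 (a * b) = \<phi>\<^sub>1 a \<otimes> \<phi>\<^sub>1 b" "\<phi>\<^sub>1 (star a) = cstar C (\<phi>\<^sub>1 a)" for a b
    using mult by (simp_all add: star_multiplicative_into_def)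
  have \<phi>2_add: "\<phi>\<^sub>2 (x \<oplus> y) = \<phi>\<^sub>2 x + \<phi>\<^sub>2 y" if "x \<in> carrier C" "y \<in> carrier C" for x y
    using pos that by (simp add: positive_linear_from_def)
  have \<phi>2_scale: "\<phi>\<^sub>2 (cscale C c x) = c *\<^sub>C \<phi>\<^sub>2 x" if "x \<in> carrier C" for x c
    using pos that by (simp add: positive_linear_from_def)
  have \<phi>2_pos: "cstar_positive (\<phi>\<^sub>2 (cstar C x \<otimes> x))" if "x \<in> carrier C" for x
    using pos that by (auto simp: positive_linear_from_def positive_in_def cstar_closed)
  have \<phi>2_minus: "\<phi>\<^sub>2 (x \<ominus> y) = \<phi>\<^sub>2 x - \<phi>\<^sub>2 y" if "x \<in> carrier C" "y \<in> carrier C" for x y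
    using that by (simp add: minus_eq a_inv_eq_cscale \<phi>2_add \<phi>2_scale cscale_closed)
  have \<phi>2_zero: "\<phi>\<^sub>2 \<zero> = 0"
    using \<phi>2_add[of \<zero> \<zero>] by simp
  \<comment> \<open>The combination of the \<open>\<phi>\<^sub>1 (x j)\<close> with coefficients
    \<open>\<alpha> j\<close>; the index \<open>Suc n\<close> in the recursion matches sums that
    start at 1.\<close>
  define T where "T x \<alpha> = rec_nat \<zero> (\<lambda>n t. t \<oplus> cscale C (\<alpha> (Suc n)) (\<phi>\<^sub>1 (x (Suc n))))"
    for x :: "nat \<Rightarrow> 'a" and \<alpha> :: "nat \<Rightarrow> complex"
  have T0 [simp]: "T x \<alpha> 0 = \<zero>"
    and TSuc [simp]: "T x \<alpha> (Suc n) = T x \<alpha> n \<oplus> cscale C (\<alpha> (Suc n)) (\<phi>\<^sub>1 (x (Suc n)))" for x \<alpha> n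
    by (simp_all add: T_def)
  have T: "T x \<alpha> n \<in> carrier C" for x \<alpha> n
    by (induction n) (simp_all add: \<phi>1 cscale_closed)
  have right: "\<phi>\<^sub>2 (z \<otimes> T x \<alpha> n) = (\<Sum>j=1..n. \<alpha> j *\<^sub>C \<phi>\<^sub>2 (z \<otimes> \<phi>\<^sub>1 (x j)))"
    if "z \<in> carrier C" for z x \<alpha> n
    by (induction n)
      (simp_all add: that T \<phi>1(1) \<phi>2_zero r_distr \<phi>2_add \<phi>2_scale cscale_closed mult_cscale_right)
  have left: "\<phi>\<^sub>2 (cstar C (T x \<alpha> n) \<otimes> z) = (\<Sum>i=1..n. cnj (\<alpha> i) *\<^sub>C \<phi>\<^sub>2 (cstar C (\<phi>\<^sub>1 (x i)) \<otimes> z))"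
    if "z \<in> carrier C" for z x \<alpha> n
    by (induction n)
      (simp_all add: that T \<phi>1(1) \<phi>2_zero l_distr \<phi>2_add \<phi>2_scale cscale_closed mult_cscale_left
        cstar_add cstar_closed cstar_cscale cstar_zero)
  \<comment> \<open>The first double sum is the case where z is b* b with b =
    \<open>\<phi>\<^sub>1 a\<close>. The second is the case where z is the unit of C, not
    \<open>\<phi>\<^sub>1 1\<close>, since \<open>\<phi>\<^sub>1\<close> need not preserve
    units.\<close>
  have gram: "\<phi>\<^sub>2 (cstar C (T x \<alpha> n) \<otimes> (z \<otimes> T x \<alpha> n))
      = (\<Sum>i=1..n. \<Sum>j=1..n. (cnj (\<alpha> i) * \<alpha> j) *\<^sub>C \<phi>\<^sub>2 (cstar C (\<phi>\<^sub>1 (x i)) \<otimes> z \<otimes> \<phi>\<^sub>1 (x j)))"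
    if "z \<in> carrier C" for z x \<alpha> n
  proof -
    have "\<phi>\<^sub>2 (cstar C (T x \<alpha> n) \<otimes> (z \<otimes> T x \<alpha> n))
        = (\<Sum>i=1..n. cnj (\<alpha> i) *\<^sub>C \<phi>\<^sub>2 (cstar C (\<phi>\<^sub>1 (x i)) \<otimes> z \<otimes> T x \<alpha> n))"
      using that by (simp add: left T \<phi>1(1) cstar_closed m_assoc)
    then show ?thesis
      using that by (simp add: right \<phi>1(1) cstar_closed scaleC.scale_sum_right)
  qed
  show ?thesis
    unfolding boundedly_positive_type_def
  proof (rule allI, intro exI conjI allI)
    fix a :: 'a
    let ?K = "(cnorm C (\<phi>\<^sub>1 a))\<^sup>2 + 1"
    show "?K > 0"
      by (simp add: add_nonneg_pos)
    fix n and x :: "nat \<Rightarrow> 'a" and \<alpha> :: "nat \<Rightarrow> complex"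
    let ?T = "T x \<alpha> n" and ?b = "\<phi>\<^sub>1 a"
    have big: "(\<Sum>i=1..n. \<Sum>j=1..n. (cnj (\<alpha> i) * \<alpha> j) *\<^sub>C (\<phi>\<^sub>2 \<circ> \<phi>\<^sub>1) (star (x i) * star a * a * x j))
        = \<phi>\<^sub>2 (cstar C (?b \<otimes> ?T) \<otimes> (?b \<otimes> ?T))"
      using gram[of "cstar C ?b \<otimes> ?b" x \<alpha> n] T[of x \<alpha> n]
      by (simp add: \<phi>1 cstar_closed cstar_mult m_assoc)
    have small: "(\<Sum>i=1..n. \<Sum>j=1..n. (cnj (\<alpha> i) * \<alpha> j) *\<^sub>C (\<phi>\<^sub>2 \<circ> \<phi>\<^sub>1) (star (x i) * x j))
        = \<phi>\<^sub>2 (cstar C ?T \<otimes> ?T)"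
      using gram[of \<one> x \<alpha> n] T[of x \<alpha> n] by (simp add: \<phi>1 cstar_closed)
    show "0 \<le>\<^sub>C (\<Sum>i=1..n. \<Sum>j=1..n.
        (cnj (\<alpha> i) * \<alpha> j) *\<^sub>C (\<phi>\<^sub>2 \<circ> \<phi>\<^sub>1) (star (x i) * star a * a * x j))"
      unfolding big using \<phi>2_pos[of "?b \<otimes> ?T"] by (simp add: cstar_le_def \<phi>1(1) T)
    obtain s where s: "s \<in> carrier C" "cstar C s \<otimes> s = cscale C (complex_of_real ?K) \<one> \<ominus> cstar C ?b \<otimes> ?b"
      using cscale_one_minus_square[OF \<phi>1(1), of a] by blast
    have "\<phi>\<^sub>2 (cstar C (s \<otimes> ?T) \<otimes> (s \<otimes> ?T)) = ?K *\<^sub>R \<phi>\<^sub>2 (cstar C ?T \<otimes> ?T) - \<phi>\<^sub>2 (cstar C (?b \<otimes> ?T) \<otimes> (?b \<otimes> ?T))"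
      using s(1) T[of x \<alpha> n]
      by (subst square_sandwich[OF T \<phi>1(1) s])
        (simp add: \<phi>1(1) \<phi>2_minus \<phi>2_scale cscale_closed cstar_closed scaleR_scaleC)
    then show "(\<Sum>i=1..n. \<Sum>j=1..n.
          (cnj (\<alpha> i) * \<alpha> j) *\<^sub>C (\<phi>\<^sub>2 \<circ> \<phi>\<^sub>1) (star (x i) * star a * a * x j))
        \<le>\<^sub>C ?K *\<^sub>R (\<Sum>i=1..n. \<Sum>j=1..n. (cnj (\<alpha> i) * \<alpha> j) *\<^sub>C (\<phi>\<^sub>2 \<circ> \<phi>\<^sub>1) (star (x i) * x j))"
      unfolding big small using \<phi>2_pos[of "s \<otimes> ?T"] s(1) T[of x \<alpha> n] by (simp add: cstar_le_def)
  qed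
qed

section \<open>The monoid algebra\<close>

text \<open>
  \<^type>\<open>poly_mapping\<close> carries a convolution product over additive monoids only, so the
  multiplicative monoid of \<open>'a\<close> is transferred to a type with additive notation; the monoid
  algebra \<open>\<complex>[A]\<close> then becomes an instance of \<^class>\<open>ring_1\<close>.
\<close>

typedef 'a additive = "UNIV :: 'a set" ..

instantiation additive :: (monoid_mult) monoid_add
begin

definition "0 = Abs_additive 1"
definition "a + b = Abs_additive (Rep_additive a * Rep_additive b)"

instance
  by standard (simp_all add: zero_additive_def plus_additive_def Abs_additive_inverse
      Rep_additive_inverse mult.assoc)

end

type_synonym 'a monoid_algebra = "'a additive \<Rightarrow>\<^sub>0 complex"

definition gen :: "'a::monoid_mult \<Rightarrow> 'a monoid_algebra"
  where "gen a = Poly_Mapping.single (Abs_additive a) 1"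

text \<open>Complex numbers sit in the algebra as multiples of its unit, so scaling becomes a ring
  product.\<close>

definition scalar :: "complex \<Rightarrow> 'a::monoid_mult monoid_algebra"
  where "scalar c = Poly_Mapping.single 0 c"

lemma gen_mult: "gen (a * b) = gen a * gen b"
  by (simp add: gen_def mult_single plus_additive_def Abs_additive_inverse)

lemma gen_one: "gen 1 = 1"
  by (simp add: gen_def flip: zero_additive_def)

lemma scalar_mult_gen: "scalar c * gen a = Poly_Mapping.single (Abs_additive a) c"
  by (simp add: gen_def scalar_def mult_single)

lemma scalar_simps [simp]:
  "scalar 0 = 0" "scalar 1 = 1"
  by (simp_all add: scalar_def)

lemma scalar_mult: "scalar (c * d) = scalar c * scalar d"
  by (simp add: scalar_def mult_single)

lemma scalar_uminus: "scalar (- c) = - scalar c"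
  by (simp add: scalar_def single_uminus)

lemma monoid_algebra_induct [case_names zero add]:
  fixes f :: "'a::monoid_mult monoid_algebra"
  assumes zero: "P 0" and add: "\<And>c a f. P f \<Longrightarrow> P (scalar c * gen a + f)"
  shows "P f"
proof (induction f rule: update_induct)
  case (update f k c)
  have "Poly_Mapping.update k c f = scalar c * gen (Rep_additive k) + f"
    using update(1)
    by (intro poly_mapping_eqI)
      (auto simp: lookup_update lookup_add lookup_single scalar_mult_gen Rep_additive_inverse
        in_keys_iff when_def)
  then show ?case using add[OF update(3)] by simp
qed (rule zero)

lemma scalar_commute: "scalar c * f = f * scalar c"
proof (induction f rule: monoid_algebra_induct)
  case (add d a f)
  have "scalar c * (scalar d * gen a) = scalar d * gen a * scalar c"
    unfolding scalar_mult_gen by (simp add: scalar_def mult_single mult.commute)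
  then show ?case using add by (simp add: distrib_left distrib_right)
qed simp

lemma scalar_scalar: "scalar c * (scalar d * f) = scalar (c * d) * f"
  by (simp add: scalar_mult mult.assoc)

lemma scalar_left_commute: "f * (scalar c * g) = scalar c * (f * g)"
  by (metis mult.assoc scalar_commute)

text \<open>Brings an element into the indexed form used in the definition of bounded positivity;
  the \<open>x i\<close> may repeat.\<close>

lemma monoid_algebra_finite_sum:
  fixes f :: "'a::monoid_mult monoid_algebra"
  obtains n :: nat and \<alpha> x where "f = (\<Sum>i=1..n. scalar (\<alpha> i) * gen (x i))"
proof -
  have "\<exists>(n::nat) \<alpha> x. f = (\<Sum>i=1..n. scalar (\<alpha> i) * gen (x i))"
  proof (induction f rule: monoid_algebra_induct)
    case zero
    show ?case by (intro exI[of _ 0]) simp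
  next
    case (add c a f)
    then obtain n :: nat and \<alpha> x where f: "f = (\<Sum>i=1..n. scalar (\<alpha> i) * gen (x i))"
      by blast
    have "scalar c * gen a + f
        = (\<Sum>i=1..Suc n. scalar ((\<alpha>(Suc n := c)) i) * gen ((x(Suc n := a)) i))"
      unfolding f sum.cl_ivl_Suc by (simp add: add.commute)
    then show ?case by blast
  qed
  then show thesis using that by blast
qed

definition adj :: "'a::unital_cstar_algebra monoid_algebra \<Rightarrow> 'a monoid_algebra"
  where "adj f = (\<Sum>k\<in>Poly_Mapping.keys f.
    Poly_Mapping.single (Abs_additive (star (Rep_additive k))) (cnj (Poly_Mapping.lookup f k)))"

lemma adj_add: "adj (f + g) = adj f + adj g"
  unfolding adj_def by (rule setsum_keys_plus_distrib) (simp_all add: single_add)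

lemma adj_zero [simp]: "adj 0 = 0"
  by (simp add: adj_def)

lemma adj_uminus: "adj (- f) = - adj f"
  using adj_add[of f "- f"] by (simp add: eq_neg_iff_add_eq_0 add.commute)

lemma adj_diff: "adj (f - g) = adj f - adj g"
  using adj_add[of f "- g"] by (simp add: adj_uminus)

lemma adj_scalar_gen: "adj (scalar c * gen a) = scalar (cnj c) * gen (star a)"
  by (cases "c = 0") (simp_all add: scalar_mult_gen adj_def Abs_additive_inverse)

lemma adj_gen: "adj (gen a) = gen (star a)"
  using adj_scalar_gen[of 1 a] by simp

lemma adj_scalar: "adj (scalar c) = scalar (cnj c)"
  using adj_scalar_gen[of c 1] by (simp add: gen_one)

lemma adj_one [simp]: "adj 1 = 1"
  using adj_scalar[of 1] by simp

lemma adj_adj [simp]: "adj (adj f) = f"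
  by (induction f rule: monoid_algebra_induct) (simp_all add: adj_add adj_scalar_gen star_star)

lemma adj_mult: "adj (f * g) = adj g * adj f"
proof (induction f rule: monoid_algebra_induct)
  case (add c a f)
  have "adj (scalar c * gen a * g) = adj g * adj (scalar c * gen a)"
  proof (induction g rule: monoid_algebra_induct)
    case (add d b g)
    have "scalar c * gen a * (scalar d * gen b) = scalar (c * d) * gen (a * b)"
      by (simp add: mult.assoc scalar_left_commute[of "gen a"] scalar_scalar gen_mult)
    moreover have "scalar (cnj d) * gen (star b) * (scalar (cnj c) * gen (star a))
        = scalar (cnj (c * d)) * gen (star (a * b))"
      by (simp add: mult.assoc scalar_left_commute[of "gen (star b)"] scalar_scalar gen_mult star_mult
          mult.commute[of "cnj d"])
    ultimately have "adj (scalar c * gen a * (scalar d * gen b))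
        = adj (scalar d * gen b) * adj (scalar c * gen a)"
      by (simp add: adj_scalar_gen)
    then show ?case using add by (simp add: adj_add distrib_left distrib_right)
  qed simp
  then show ?case using add by (simp add: adj_add distrib_left distrib_right)
qed simp

definition linear_extension ::
    "('a::monoid_mult \<Rightarrow> 'b::unital_cstar_algebra) \<Rightarrow> 'a monoid_algebra \<Rightarrow> 'b"
  where "linear_extension \<phi> f
    = (\<Sum>k\<in>Poly_Mapping.keys f. Poly_Mapping.lookup f k *\<^sub>C \<phi> (Rep_additive k))"

lemma linear_extension_add:
  "linear_extension \<phi> (f + g) = linear_extension \<phi> f + linear_extension \<phi> g"
  unfolding linear_extension_def
  by (rule setsum_keys_plus_distrib) (simp_all add: scaleC_add_left)

lemma linear_extension_zero [simp]: "linear_extension \<phi> 0 = 0"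
  by (simp add: linear_extension_def)

lemma linear_extension_scalar_gen: "linear_extension \<phi> (scalar c * gen a) = c *\<^sub>C \<phi> a"
  by (cases "c = 0") (simp_all add: scalar_mult_gen linear_extension_def Abs_additive_inverse)

lemma linear_extension_gen: "linear_extension \<phi> (gen a) = \<phi> a"
  using linear_extension_scalar_gen[of \<phi> 1 a] by simp

lemma linear_extension_scalar: "linear_extension \<phi> (scalar c * f) = c *\<^sub>C linear_extension \<phi> f"
proof (induction f rule: monoid_algebra_induct)
  case (add d a f)
  have "scalar c * (scalar d * gen a) = scalar (c * d) * gen a"
    by (simp add: scalar_mult mult.assoc)
  then show ?case
    using add by (simp add: distrib_left linear_extension_add linear_extension_scalar_gen
        scaleC_add_right scaleC_scaleC)
qed simp

lemma linear_extension_uminus: "linear_extension \<phi> (- f) = - linear_extension \<phi> f"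
  using linear_extension_add[of \<phi> f "- f"] by (simp add: eq_neg_iff_add_eq_0 add.commute)

section \<open>The C*-seminorm of a map of boundedly positive type\<close>

lemma cstar_le_iff_psd: "a \<le>\<^sub>C b \<longleftrightarrow> psd (b - a)"
  by (simp add: cstar_le_def cstar_positive_iff_psd)

text \<open>From -v \<le> u \<le> v follows 0 \<le> v + u \<le> 2 v, so v + u has norm at most twice
  that of v. The constant 3 is enough for continuity estimates.\<close>

lemma norm_le_of_two_sided:
  assumes "psd (v - u)" "psd (v + u)"
  shows "norm u \<le> 3 * norm v"
proof -
  have "norm (v + u) \<le> norm (v + v)"
    using assms by (intro psd_norm_mono) simp_all
  then show ?thesis
    using norm_triangle_ineq4[of "v + u" v] norm_triangle_ineq[of v v] by simp
qed

locale boundedly_positive =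
  fixes \<phi> :: "'a::unital_cstar_algebra \<Rightarrow> 'b::unital_cstar_algebra"
  assumes bounded_type: "boundedly_positive_type \<phi>"
begin

section \<open>The form with values in B\<close>

definition ip :: "'a monoid_algebra \<Rightarrow> 'a monoid_algebra \<Rightarrow> 'b"
  where "ip g h = linear_extension \<phi> (adj g * h)"

lemma ip_add_left: "ip (g + g') h = ip g h + ip g' h"
  by (simp add: ip_def adj_add distrib_right linear_extension_add)

lemma ip_add_right: "ip g (h + h') = ip g h + ip g h'"
  by (simp add: ip_def distrib_left linear_extension_add)

lemma ip_zero [simp]: "ip 0 h = 0" "ip g 0 = 0"
  by (simp_all add: ip_def)

lemma ip_uminus_left: "ip (- g) h = - ip g h"
  by (simp add: ip_def adj_uminus linear_extension_uminus)

lemma ip_uminus_right: "ip g (- h) = - ip g h"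
  by (simp add: ip_def linear_extension_uminus)

lemma ip_diff_left: "ip (g - g') h = ip g h - ip g' h"
  using ip_add_left[of g "- g'" h] by (simp add: ip_uminus_left)

lemma ip_diff_right: "ip g (h - h') = ip g h - ip g h'"
  using ip_add_right[of g h "- h'"] by (simp add: ip_uminus_right)

lemma ip_scalar_left: "ip (scalar c * g) h = cnj c *\<^sub>C ip g h"
proof -
  have "adj (scalar c * g) * h = scalar (cnj c) * (adj g * h)"
    by (simp add: adj_mult adj_scalar mult.assoc scalar_left_commute)
  then show ?thesis by (simp add: ip_def linear_extension_scalar)
qed

lemma ip_scalar_right: "ip g (scalar c * h) = c *\<^sub>C ip g h"
proof -
  have "adj g * (scalar c * h) = scalar c * (adj g * h)"
    by (rule scalar_left_commute)
  then show ?thesis by (simp add: ip_def linear_extension_scalar)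
qed

lemmas ip_bilinear = ip_add_left ip_add_right ip_diff_left ip_diff_right ip_uminus_left
  ip_uminus_right ip_scalar_left ip_scalar_right

lemma ip_mult_left: "ip (f * g) h = ip g (adj f * h)"
  by (simp add: ip_def adj_mult mult.assoc)

lemma ip_gen: "ip (gen a) (gen b * gen c) = \<phi> (star a * b * c)"
  by (simp add: ip_def adj_gen linear_extension_gen flip: gen_mult)
    (simp add: mult.assoc)

text \<open>For \<open>b = star a * a\<close> and \<open>b = 1\<close> these are the two double sums
  in the definition of bounded positivity.\<close>

lemma ip_gram:
  fixes n :: nat
  assumes "g = (\<Sum>i=1..n. scalar (\<alpha> i) * gen (x i))"
  shows "ip g (gen b * g) = (\<Sum>i=1..n. \<Sum>j=1..n. (cnj (\<alpha> i) * \<alpha> j) *\<^sub>C \<phi> (star (x i) * b * x j))"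
proof -
  have left: "ip (sum f I) h = (\<Sum>i\<in>I. ip (f i) h)" for f h and I :: "nat set"
    by (induction I rule: infinite_finite_induct) (simp_all add: ip_add_left)
  have right: "ip h (sum f I) = (\<Sum>i\<in>I. ip h (f i))" for f h and I :: "nat set"
    by (induction I rule: infinite_finite_induct) (simp_all add: ip_add_right)
  have "gen b * g = (\<Sum>j=1..n. scalar (\<alpha> j) * (gen b * gen (x j)))"
    unfolding assms sum_distrib_left by (simp only: scalar_left_commute)
  then have "ip g (gen b * g) = (\<Sum>i=1..n. ip (scalar (\<alpha> i) * gen (x i))
      (\<Sum>j=1..n. scalar (\<alpha> j) * (gen b * gen (x j))))"
    by (simp only:) (simp only: assms left)
  also have "\<dots> = (\<Sum>i=1..n. \<Sum>j=1..n. (cnj (\<alpha> i) * \<alpha> j) *\<^sub>C \<phi> (star (x i) * b * x j))"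
    by (simp add: right ip_scalar_left ip_scalar_right ip_gen scaleC.scale_sum_right scaleC_scaleC
        mult.commute)
  finally show ?thesis .
qed

lemma ip_gen_bounded:
  "\<exists>K>0. \<forall>g. psd (ip (gen a * g) (gen a * g)) \<and>
     psd (K *\<^sub>R ip g g - ip (gen a * g) (gen a * g))"
proof -
  obtain K where "K > 0" and K: "\<forall>(n::nat) x \<alpha>.
      0 \<le>\<^sub>C (\<Sum>i=1..n. \<Sum>j=1..n. (cnj (\<alpha> i) * \<alpha> j) *\<^sub>C \<phi> (star (x i) * star a * a * x j)) \<and>
      (\<Sum>i=1..n. \<Sum>j=1..n. (cnj (\<alpha> i) * \<alpha> j) *\<^sub>C \<phi> (star (x i) * star a * a * x j))
        \<le>\<^sub>C K *\<^sub>R (\<Sum>i=1..n. \<Sum>j=1..n. (cnj (\<alpha> i) * \<alpha> j) *\<^sub>C \<phi> (star (x i) * x j))"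
    using spec[OF bounded_type[unfolded boundedly_positive_type_def], of a]
    by (elim exE conjE) (rule that)
  have *: "psd (ip (gen a * g) (gen a * g)) \<and> psd (K *\<^sub>R ip g g - ip (gen a * g) (gen a * g))" for g
  proof -
    obtain n :: nat and \<alpha> x where g: "g = (\<Sum>i=1..n. scalar (\<alpha> i) * gen (x i))"
      by (rule monoid_algebra_finite_sum)
    have "ip (gen a * g) (gen a * g) = ip g (gen (star a * a) * g)"
      by (simp add: ip_mult_left adj_gen gen_mult mult.assoc)
    moreover have "ip g g = ip g (gen 1 * g)"
      by (simp add: gen_one)
    ultimately show ?thesis
      using spec[OF spec[OF spec[OF K, of n], of x], of \<alpha>]
      by (simp add: ip_gram[OF g] cstar_le_iff_psd mult.assoc)
  qed
  show ?thesis
    using \<open>K > 0\<close> * by (intro exI[of _ K]) simp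
qed

text \<open>Bounded positivity at the unit of A, whose image in the monoid algebra is 1.\<close>

lemma ip_psd: "psd (ip g g)"
  using ip_gen_bounded[of 1] by (auto simp: gen_one)

text \<open>Polarization: \<open>ip\<close> on the diagonal is self-adjoint, and expanding it at g +
  h and at g + i h gives two linear equations for the adjoints of the mixed terms.\<close>

lemma ip_hermitian: "star (ip g h) = ip h g"
proof -
  have "star (ip (g + h) (g + h)) = ip (g + h) (g + h)"
    by (rule psd_selfadjoint[OF ip_psd])
  then have 1: "star (ip g h) + star (ip h g) = ip g h + ip h g"
    using psd_selfadjoint[OF ip_psd, of g] psd_selfadjoint[OF ip_psd, of h]
    by (simp add: ip_bilinear star_add algebra_simps)
  let ?k = "g + scalar \<i> * h"
  have "star (ip ?k ?k) = ip ?k ?k"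
    by (rule psd_selfadjoint[OF ip_psd])
  then have "\<i> *\<^sub>C (star (ip h g) - star (ip g h)) = \<i> *\<^sub>C (ip g h - ip h g)"
    using psd_selfadjoint[OF ip_psd, of g] psd_selfadjoint[OF ip_psd, of h]
    by (simp add: ip_bilinear star_add star_scaleC star_diff algebra_simps scaleC_scaleC)
  then have "(- \<i>) *\<^sub>C \<i> *\<^sub>C (star (ip h g) - star (ip g h)) = (- \<i>) *\<^sub>C \<i> *\<^sub>C (ip g h - ip h g)"
    by simp
  then have 2: "star (ip h g) - star (ip g h) = ip g h - ip h g"
    by (simp only: scaleC_scaleC) simp
  have "star (ip g h) + star (ip g h) = (star (ip g h) + star (ip h g)) - (star (ip h g) - star (ip g h))"
    by simp
  also have "\<dots> = ip h g + ip h g"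
    unfolding 1 2 by simp
  finally show ?thesis
    by (simp flip: scaleR_2)
qed

text \<open>Expand the form at sqrt c g - h / sqrt c. This weighted additive form of the
  Cauchy-Schwarz inequality makes sense in the order of a noncommutative B, and the free weight c is
  tuned in each application.\<close>

lemma ip_cauchy_schwarz:
  assumes "c > 0"
  shows "psd (c *\<^sub>R ip g g + (1 / c) *\<^sub>R ip h h - (ip g h + ip h g))"
proof -
  let ?u = "scalar (complex_of_real (sqrt c)) * g - scalar (complex_of_real (1 / sqrt c)) * h"
  have "ip ?u ?u = c *\<^sub>R ip g g + (1 / c) *\<^sub>R ip h h - (ip g h + ip h g)"
    using assms by (simp add: ip_bilinear scaleR_scaleC scaleC_scaleC scaleC.scale_right_diff_distrib
        algebra_simps flip: of_real_mult)
  then show ?thesis using ip_psd[of ?u] by simp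
qed

section \<open>Bounds for left multiplications\<close>

definition left_bound :: "'a monoid_algebra \<Rightarrow> real \<Rightarrow> bool"
  where "left_bound f k \<longleftrightarrow> k > 0 \<and> (\<forall>g. psd (k\<^sup>2 *\<^sub>R ip g g - ip (f * g) (f * g)))"

lemma left_boundD: "left_bound f k \<Longrightarrow> psd (k\<^sup>2 *\<^sub>R ip g g - ip (f * g) (f * g))"
  by (simp add: left_bound_def)

lemma left_bound_pos: "left_bound f k \<Longrightarrow> k > 0"
  by (simp add: left_bound_def)

lemma left_bound_mono:
  assumes f: "left_bound f k" and "k \<le> l"
  shows "left_bound f l"
  unfolding left_bound_def
proof (intro conjI allI)
  have k: "k > 0" using f by (rule left_bound_pos)
  with \<open>k \<le> l\<close> show "l > 0" by simp
  fix g
  have "0 \<le> l\<^sup>2 - k\<^sup>2"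
    using k \<open>k \<le> l\<close> by simp
  then have "psd ((l\<^sup>2 - k\<^sup>2) *\<^sub>R ip g g + (k\<^sup>2 *\<^sub>R ip g g - ip (f * g) (f * g)))"
    by (intro psd_add psd_scaleR ip_psd left_boundD[OF f])
  then show "psd (l\<^sup>2 *\<^sub>R ip g g - ip (f * g) (f * g))"
    by (simp add: algebra_simps)
qed

text \<open>The mixed terms are estimated with weight c = l / k, the choice for which (1 + l/k) k^2
  + (1 + k/l) l^2 is exactly (k + l)^2.\<close>

lemma left_bound_add:
  assumes f: "left_bound f k" and f': "left_bound f' l"
  shows "left_bound (f + f') (k + l)"
  unfolding left_bound_def
proof (intro conjI allI)
  have k: "k > 0" "l > 0" using f f' by (auto intro: left_bound_pos)
  then show "k + l > 0" by simp
  fix g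
  let ?A = "ip (f * g) (f * g)" and ?B = "ip (f' * g) (f' * g)"
    and ?X = "ip (f * g) (f' * g) + ip (f' * g) (f * g)" and ?I = "ip g g"
  have collect: "(1 + s) *\<^sub>R (p *\<^sub>R I - A) + (1 + t) *\<^sub>R (q *\<^sub>R I - B) + (s *\<^sub>R A + t *\<^sub>R B - X)
      = ((1 + s) * p + (1 + t) * q) *\<^sub>R I - (A + B + X)" for s t p q and A B I X :: 'b
    by (simp add: algebra_simps)
  have "psd ((l / k) *\<^sub>R ?A + (k / l) *\<^sub>R ?B - ?X)"
    using ip_cauchy_schwarz[of "l / k" "f * g" "f' * g"] k by simp
  then have "psd ((1 + l / k) *\<^sub>R (k\<^sup>2 *\<^sub>R ?I - ?A) + (1 + k / l) *\<^sub>R (l\<^sup>2 *\<^sub>R ?I - ?B)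
      + ((l / k) *\<^sub>R ?A + (k / l) *\<^sub>R ?B - ?X))"
    using k by (intro psd_add psd_scaleR left_boundD f f') simp_all
  also note collect
  also have "(1 + l / k) * k\<^sup>2 + (1 + k / l) * l\<^sup>2 = (k + l)\<^sup>2"
    using k by (simp add: field_simps power2_eq_square)
  also have "?A + ?B + ?X = ip ((f + f') * g) ((f + f') * g)"
    by (simp add: distrib_right ip_bilinear algebra_simps)
  finally show "psd ((k + l)\<^sup>2 *\<^sub>R ip g g - ip ((f + f') * g) ((f + f') * g))" .
qed

lemma left_bound_mult:
  assumes f: "left_bound f k" and f': "left_bound f' l"
  shows "left_bound (f * f') (k * l)"
  unfolding left_bound_def
proof (intro conjI allI)
  show "k * l > 0" using f f' by (intro mult_pos_pos left_bound_pos)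
  fix g
  have "psd ((k\<^sup>2 *\<^sub>R ip (f' * g) (f' * g) - ip (f * (f' * g)) (f * (f' * g)))
      + k\<^sup>2 *\<^sub>R (l\<^sup>2 *\<^sub>R ip g g - ip (f' * g) (f' * g)))"
    by (intro psd_add psd_scaleR left_boundD f f') simp
  then show "psd ((k * l)\<^sup>2 *\<^sub>R ip g g - ip (f * f' * g) (f * f' * g))"
    by (simp add: scaleR_diff_right power_mult_distrib mult.assoc)
qed

lemma left_bound_scalar:
  assumes f: "left_bound f k" and "c \<noteq> 0"
  shows "left_bound (scalar c * f) (cmod c * k)"
  unfolding left_bound_def
proof (intro conjI allI)
  show "cmod c * k > 0" using assms left_bound_pos[OF f] by simp
  fix g
  have "ip (scalar c * f * g) (scalar c * f * g) = (cmod c)\<^sup>2 *\<^sub>R ip (f * g) (f * g)"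
    by (simp add: mult.assoc ip_scalar_left ip_scalar_right scaleC_scaleC scaleR_scaleC
        mult.commute[of "cnj c"] flip: complex_norm_square)
  then show "psd ((cmod c * k)\<^sup>2 *\<^sub>R ip g g - ip (scalar c * f * g) (scalar c * f * g))"
    using psd_scaleR[OF left_boundD[OF f, of g], of "(cmod c)\<^sup>2"]
    by (simp add: scaleR_diff_right power_mult_distrib)
qed

text \<open>For h = \<open>adj f * g\<close>, weight k^2 gives 2 <h, h> \<le> k^2 <g, g> + k^-2 <f
  h, f h>, and the last term is at most <h, h>; cancel one <h, h>.\<close>

lemma left_bound_adj:
  assumes f: "left_bound f k"
  shows "left_bound (adj f) k"
  unfolding left_bound_def
proof (intro conjI allI)
  show k: "k > 0" using f by (rule left_bound_pos)
  fix g
  let ?h = "adj f * g"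
  have "ip ?h ?h = ip g (f * ?h)" "ip ?h ?h = ip (f * ?h) g"
    by (simp_all add: ip_mult_left)
  then have "psd (k\<^sup>2 *\<^sub>R ip g g + (1 / k\<^sup>2) *\<^sub>R ip (f * ?h) (f * ?h) - (ip ?h ?h + ip ?h ?h))"
    using ip_cauchy_schwarz[of "k\<^sup>2" g "f * ?h"] k by simp
  moreover have "psd ((1 / k\<^sup>2) *\<^sub>R (k\<^sup>2 *\<^sub>R ip ?h ?h - ip (f * ?h) (f * ?h)))"
    by (intro psd_scaleR left_boundD f) simp
  ultimately have "psd ((k\<^sup>2 *\<^sub>R ip g g + (1 / k\<^sup>2) *\<^sub>R ip (f * ?h) (f * ?h) - (ip ?h ?h + ip ?h ?h))
      + (1 / k\<^sup>2) *\<^sub>R (k\<^sup>2 *\<^sub>R ip ?h ?h - ip (f * ?h) (f * ?h)))"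
    by (rule psd_add)
  then show "psd (k\<^sup>2 *\<^sub>R ip g g - ip ?h ?h)"
    using k by (simp add: scaleR_diff_right)
qed

text \<open>The nontrivial half of the C*-identity. For h = \<open>adj f * f * g\<close>, weight m
  gives 2 <f g, f g> \<le> m <g, g> + m^-1 <h, h>, and the last term is at most m <g, g>.\<close>

lemma left_bound_sqrt:
  assumes f: "left_bound (adj f * f) m"
  shows "left_bound f (sqrt m)"
  unfolding left_bound_def
proof (intro conjI allI)
  have m: "m > 0" using f by (rule left_bound_pos)
  then show "sqrt m > 0" by simp
  fix g
  let ?h = "adj f * f * g"
  have "ip (f * g) (f * g) = ip g ?h" "ip (f * g) (f * g) = ip ?h g"
    by (simp_all add: ip_mult_left mult.assoc)
  then have "psd (m *\<^sub>R ip g g + (1 / m) *\<^sub>R ip ?h ?h - (ip (f * g) (f * g) + ip (f * g) (f * g)))"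
    using ip_cauchy_schwarz[OF m, of g ?h] by simp
  moreover have "psd ((1 / m) *\<^sub>R (m\<^sup>2 *\<^sub>R ip g g - ip ?h ?h))"
    using m by (intro psd_scaleR left_boundD f) simp
  ultimately have "psd ((m *\<^sub>R ip g g + (1 / m) *\<^sub>R ip ?h ?h
      - (ip (f * g) (f * g) + ip (f * g) (f * g))) + (1 / m) *\<^sub>R (m\<^sup>2 *\<^sub>R ip g g - ip ?h ?h))"
    by (rule psd_add)
  also have "(m *\<^sub>R ip g g + (1 / m) *\<^sub>R ip ?h ?h - (ip (f * g) (f * g) + ip (f * g) (f * g)))
      + (1 / m) *\<^sub>R (m\<^sup>2 *\<^sub>R ip g g - ip ?h ?h) = 2 *\<^sub>R (m *\<^sub>R ip g g - ip (f * g) (f * g))"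
    using m by (simp add: scaleR_diff_right scaleR_2 power2_eq_square) (simp flip: scaleR_2)
  finally have "psd (2 *\<^sub>R (m *\<^sub>R ip g g - ip (f * g) (f * g)))" .
  from psd_scaleR[OF this, of "1 / 2"]
  show "psd ((sqrt m)\<^sup>2 *\<^sub>R ip g g - ip (f * g) (f * g))"
    using m by simp
qed

lemma left_bound_zero: "k > 0 \<Longrightarrow> left_bound 0 k"
  by (simp add: left_bound_def psd_scaleR ip_psd)

lemma left_bound_gen: "\<exists>k. left_bound (gen a) k"
proof -
  obtain K where "K > 0" "\<And>g. psd (K *\<^sub>R ip g g - ip (gen a * g) (gen a * g))"
    using ip_gen_bounded by blast
  then have "left_bound (gen a) (sqrt K)"
    by (simp add: left_bound_def)
  then show ?thesis by blast
qed

lemma left_bound_exists: "\<exists>k. left_bound f k"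
proof (induction f rule: monoid_algebra_induct)
  case zero
  show ?case using left_bound_zero[of 1] by auto
next
  case (add c a f)
  show ?case
  \<comment> \<open>For c = 0 the scaled bound would be 0, whereas bounds are strictly positive so
    that they can serve as divisors.\<close>
  proof (cases "c = 0")
    case False
    from add obtain k where k: "left_bound f k" by blast
    obtain l where "left_bound (gen a) l"
      using left_bound_gen by blast
    from left_bound_add[OF left_bound_scalar[OF this False] k] show ?thesis by blast
  qed (use add in simp)
qed

section \<open>The C*-seminorm\<close>

definition seminorm :: "'a monoid_algebra \<Rightarrow> real"
  where "seminorm f = Inf {k. left_bound f k}"

lemma bdd_below_left_bound: "bdd_below {k. left_bound f k}"
  by (rule bdd_belowI[of _ 0]) (auto dest: left_bound_pos)

lemma seminorm_le: "left_bound f k \<Longrightarrow> seminorm f \<le> k"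
  unfolding seminorm_def by (rule cInf_lower[OF _ bdd_below_left_bound]) simp

text \<open>Only numbers strictly above the infimum are used as bounds; the estimates below
  therefore add a small slack and let it tend to 0.\<close>

lemma left_bound_of_seminorm: "seminorm f < k \<Longrightarrow> left_bound f k"
  using left_bound_exists[of f] cInf_lessD[of "{k. left_bound f k}" k] left_bound_mono[of f _ k]
  by (auto simp: seminorm_def)

lemma seminorm_nonneg: "0 \<le> seminorm f"
  unfolding seminorm_def
proof (rule cInf_greatest)
  show "{k. left_bound f k} \<noteq> {}"
    using left_bound_exists[of f] by simp
  show "0 \<le> k" if "k \<in> {k. left_bound f k}" for k
    using that left_bound_pos[of f k] by simp
qed

lemma seminorm_leI:
  assumes "\<And>k. k > seminorm f \<Longrightarrow> left_bound g k"
  shows "seminorm g \<le> seminorm f"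
  by (rule dense_ge) (rule seminorm_le[OF assms])

lemma seminorm_add: "seminorm (f + g) \<le> seminorm f + seminorm g"
proof (rule field_le_epsilon)
  fix e :: real assume "e > 0"
  then have "left_bound (f + g) ((seminorm f + e / 2) + (seminorm g + e / 2))"
    by (intro left_bound_add left_bound_of_seminorm) simp_all
  from seminorm_le[OF this] show "seminorm (f + g) \<le> seminorm f + seminorm g + e"
    by simp
qed

lemma seminorm_mult: "seminorm (f * g) \<le> seminorm f * seminorm g"
proof -
  let ?F = "\<lambda>n. (seminorm f + 1 / real (Suc n)) * (seminorm g + 1 / real (Suc n))"
  have "?F \<longlonglongrightarrow> (seminorm f + 0) * (seminorm g + 0)"
    by (intro tendsto_intros LIMSEQ_Suc lim_1_over_n)
  moreover have "seminorm (f * g) \<le> ?F n" for n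
    by (intro seminorm_le left_bound_mult left_bound_of_seminorm) simp_all
  ultimately show ?thesis
    by (intro LIMSEQ_le_const) auto
qed

lemma seminorm_scalar_le:
  assumes "c \<noteq> 0"
  shows "seminorm (scalar c * f) \<le> cmod c * seminorm f"
proof -
  let ?F = "\<lambda>n. cmod c * (seminorm f + 1 / real (Suc n))"
  have "?F \<longlonglongrightarrow> cmod c * (seminorm f + 0)"
    by (intro tendsto_intros LIMSEQ_Suc lim_1_over_n)
  moreover have "seminorm (scalar c * f) \<le> ?F n" for n
    using assms by (intro seminorm_le left_bound_scalar left_bound_of_seminorm) simp_all
  ultimately show ?thesis
    by (intro LIMSEQ_le_const) auto
qed

lemma seminorm_zero [simp]: "seminorm 0 = 0"
proof (rule antisym)
  show "seminorm 0 \<le> 0"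
    by (rule dense_ge) (rule seminorm_le[OF left_bound_zero])
qed (rule seminorm_nonneg)

text \<open>The inequality for c together with the one for 1 / c gives equality.\<close>

lemma seminorm_scalar: "seminorm (scalar c * f) = cmod c * seminorm f"
proof (cases "c = 0")
  case False
  have "scalar (1 / c) * (scalar c * f) = f"
    using False by (simp flip: mult.assoc scalar_mult)
  then have "seminorm f \<le> seminorm (scalar c * f) / cmod c"
    using seminorm_scalar_le[of "1 / c" "scalar c * f"] False by (simp add: norm_divide)
  then show ?thesis
    using seminorm_scalar_le[OF False, of f] False by (simp add: field_simps)
qed simp

lemma seminorm_uminus: "seminorm (- f) = seminorm f"
  using seminorm_scalar[of "- 1" f] by (simp add: scalar_uminus)

lemma seminorm_minus_commute: "seminorm (f - g) = seminorm (g - f)"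
  using seminorm_uminus[of "f - g"] by simp

lemma seminorm_diff_triangle: "seminorm (f - h) \<le> seminorm (f - g) + seminorm (g - h)"
  using seminorm_add[of "f - g" "g - h"] by simp

lemma seminorm_diff_le: "\<bar>seminorm f - seminorm g\<bar> \<le> seminorm (f - g)"
  using seminorm_add[of "f - g" g] seminorm_add[of "g - f" f] seminorm_minus_commute[of f g] by simp

lemma seminorm_adj: "seminorm (adj f) = seminorm f"
proof (rule antisym)
  show le: "seminorm (adj f) \<le> seminorm f" for f
    by (intro seminorm_leI left_bound_adj left_bound_of_seminorm)
  show "seminorm f \<le> seminorm (adj f)"
    using le[of "adj f"] by simp
qed

lemma seminorm_adj_mult: "seminorm (adj f * f) = (seminorm f)\<^sup>2"
proof (rule antisym)
  show "seminorm (adj f * f) \<le> (seminorm f)\<^sup>2"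
    using seminorm_mult[of "adj f" f] by (simp add: seminorm_adj power2_eq_square)
  show "(seminorm f)\<^sup>2 \<le> seminorm (adj f * f)"
  proof (rule dense_ge)
    fix m assume "seminorm (adj f * f) < m"
    then have b: "left_bound (adj f * f) m"
      by (rule left_bound_of_seminorm)
    from seminorm_le[OF left_bound_sqrt[OF b]] have "(seminorm f)\<^sup>2 \<le> (sqrt m)\<^sup>2"
      by (intro power_mono seminorm_nonneg)
    then show "(seminorm f)\<^sup>2 \<le> m"
      using left_bound_pos[OF b] by simp
  qed
qed

section \<open>Continuity of the form with respect to the seminorm\<close>

lemma norm_ip_sum_le:
  assumes k: "left_bound f k"
  shows "norm (ip g (f * h) + ip (f * h) g) \<le> 3 * k * (norm (ip g g) + norm (ip h h))"
proof -
  have "k > 0" using k by (rule left_bound_pos)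
  let ?z = "ip g (f * h) + ip (f * h) g" and ?v = "k *\<^sub>R (ip g g + ip h h)"
  \<comment> \<open>Cauchy-Schwarz with weight k, then the bound for f at h. Taking g' as g and as
    -g yields the two sides required by \<open>norm_le_of_two_sided\<close>.\<close>
  have *: "psd (?v - (ip g' (f * h) + ip (f * h) g'))" if "ip g' g' = ip g g" for g'
  proof -
    have "psd ((k *\<^sub>R ip g' g' + (1 / k) *\<^sub>R ip (f * h) (f * h) - (ip g' (f * h) + ip (f * h) g'))
        + (1 / k) *\<^sub>R (k\<^sup>2 *\<^sub>R ip h h - ip (f * h) (f * h)))"
      using \<open>k > 0\<close> by (intro psd_add psd_scaleR ip_cauchy_schwarz left_boundD k) simp_all
    then show ?thesis
      using \<open>k > 0\<close> that
      by (simp add: scaleR_diff_right scaleR_add_right power2_eq_square algebra_simps)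
  qed
  have "norm ?z \<le> 3 * norm ?v"
    using *[of g] *[of "- g"] by (intro norm_le_of_two_sided) (simp_all add: ip_bilinear algebra_simps)
  also have "\<dots> \<le> 3 * (k * (norm (ip g g) + norm (ip h h)))"
    using \<open>k > 0\<close> norm_triangle_ineq[of "ip g g" "ip h h"] by simp
  finally show ?thesis by simp
qed

text \<open>Split z = \<open>ip g (f * h)\<close> into z + z* and z - z*. The first is bounded by
  the previous lemma; the second becomes a sum of the same kind after replacing g by i g, which
  leaves \<open>ip g g\<close> unchanged.\<close>

lemma norm_ip_mult_le: "norm (ip g (f * h)) \<le> 3 * (norm (ip g g) + norm (ip h h)) * seminorm f"
proof -
  let ?M = "3 * (norm (ip g g) + norm (ip h h))"
  have *: "norm (ip g (f * h)) \<le> ?M * k" if k: "left_bound f k" for k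
  proof -
    let ?z = "ip g (f * h)" and ?g = "scalar \<i> * g"
    have 1: "norm (?z + star ?z) \<le> ?M * k"
      using norm_ip_sum_le[OF k, of g h] by (simp add: ip_hermitian algebra_simps)
    have z: "ip ?g (f * h) + ip (f * h) ?g = (- \<i>) *\<^sub>C (?z - star ?z)"
      by (simp add: ip_bilinear ip_hermitian scaleC.scale_right_diff_distrib)
    have g: "ip ?g ?g = ip g g"
      by (simp add: ip_bilinear scaleC_scaleC)
    have 2: "norm (?z - star ?z) \<le> ?M * k"
      using norm_ip_sum_le[OF k, of ?g h] unfolding z g norm_scaleC by (simp add: mult_ac)
    have "2 *\<^sub>R ?z = (?z + star ?z) + (?z - star ?z)"
      by (simp add: scaleR_2)
    then have "2 * norm ?z \<le> norm (?z + star ?z) + norm (?z - star ?z)"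
      using norm_triangle_ineq[of "?z + star ?z" "?z - star ?z"] norm_scaleR[of 2 ?z] by simp
    with 1 2 show ?thesis by simp
  qed
  let ?F = "\<lambda>n. ?M * (seminorm f + 1 / real (Suc n))"
  have "?F \<longlonglongrightarrow> ?M * (seminorm f + 0)"
    by (intro tendsto_intros LIMSEQ_Suc lim_1_over_n)
  moreover have "norm (ip g (f * h)) \<le> ?F n" for n
    by (intro * left_bound_of_seminorm) simp
  ultimately show ?thesis
    by (intro LIMSEQ_le_const) auto
qed

end

section \<open>The completion\<close>

lemma null_sequence_comparison:
  fixes f :: "nat \<Rightarrow> 'a::real_normed_vector"
  assumes "g \<longlonglongrightarrow> 0" "\<And>n. norm (f n) \<le> g n"
  shows "f \<longlonglongrightarrow> 0"
  by (rule tendsto_0_le[OF assms(1), where K = 1])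
    (simp add: order_trans[OF assms(2)] always_eventually)

context boundedly_positive
begin

section \<open>Cauchy sequences and the functions that they represent\<close>

definition seminorm_Cauchy :: "(nat \<Rightarrow> 'a monoid_algebra) \<Rightarrow> bool"
  where "seminorm_Cauchy s \<longleftrightarrow> (\<forall>e>0. \<exists>N. \<forall>m\<ge>N. \<forall>n\<ge>N. seminorm (s m - s n) < e)"

definition represents :: "(nat \<Rightarrow> 'a monoid_algebra) \<Rightarrow> ('a \<Rightarrow> 'a \<Rightarrow> 'b) \<Rightarrow> bool"
  where "represents s T \<longleftrightarrow> seminorm_Cauchy s \<and>
    (\<forall>a b. (\<lambda>n. ip (gen a) (s n * gen b)) \<longlonglongrightarrow> T a b)"

lemma representsD:
  assumes "represents s T"
  shows "seminorm_Cauchy s" "(\<lambda>n. ip (gen a) (s n * gen b)) \<longlonglongrightarrow> T a b"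
  using assms by (simp_all add: represents_def)

lemma represents_unique: "represents s S \<Longrightarrow> represents s T \<Longrightarrow> S = T"
  by (intro ext) (meson LIMSEQ_unique representsD(2))

lemma seminorm_CauchyI:
  assumes s: "seminorm_Cauchy s" and t: "seminorm_Cauchy t" and "0 \<le> k" "0 \<le> l"
    and le: "\<And>m n. seminorm (u m - u n) \<le> k * seminorm (s m - s n) + l * seminorm (t m - t n)"
  shows "seminorm_Cauchy u"
  unfolding seminorm_Cauchy_def
proof (intro allI impI)
  fix e :: real assume "e > 0"
  define d where "d = e / (k + l + 1)"
  have "d > 0" using \<open>e > 0\<close> \<open>0 \<le> k\<close> \<open>0 \<le> l\<close> by (simp add: d_def)
  then obtain M N where M: "\<And>m n. m \<ge> M \<Longrightarrow> n \<ge> M \<Longrightarrow> seminorm (s m - s n) < d"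
    and N: "\<And>m n. m \<ge> N \<Longrightarrow> n \<ge> N \<Longrightarrow> seminorm (t m - t n) < d"
    using s t unfolding seminorm_Cauchy_def by meson
  have "seminorm (u m - u n) < e" if "m \<ge> max M N" "n \<ge> max M N" for m n
  proof -
    have "seminorm (u m - u n) \<le> k * d + l * d"
      using M[of m n] N[of m n] that \<open>0 \<le> k\<close> \<open>0 \<le> l\<close>
      by (intro order_trans[OF le] add_mono mult_left_mono) auto
    also have "\<dots> < (k + l + 1) * d"
      using \<open>d > 0\<close> by (simp add: algebra_simps)
    also have "\<dots> = e"
      using \<open>0 \<le> k\<close> \<open>0 \<le> l\<close> by (simp add: d_def)
    finally show ?thesis .
  qed
  then show "\<exists>N. \<forall>m\<ge>N. \<forall>n\<ge>N. seminorm (u m - u n) < e" by blast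
qed

lemma seminorm_Cauchy_const: "seminorm_Cauchy (\<lambda>n. f)"
  by (auto simp: seminorm_Cauchy_def)

lemma seminorm_Cauchy_add:
  assumes "seminorm_Cauchy s" "seminorm_Cauchy t"
  shows "seminorm_Cauchy (\<lambda>n. s n + t n)"
proof (rule seminorm_CauchyI[OF assms, of 1 1])
  show "seminorm ((s m + t m) - (s n + t n)) \<le> 1 * seminorm (s m - s n) + 1 * seminorm (t m - t n)" for m n
    using seminorm_add[of "s m - s n" "t m - t n"] by (simp add: algebra_simps)
qed simp_all

lemma seminorm_Cauchy_scalar: "seminorm_Cauchy s \<Longrightarrow> seminorm_Cauchy (\<lambda>n. scalar c * s n)"
  by (rule seminorm_CauchyI[of s s "cmod c" 0])
    (simp_all add: seminorm_scalar flip: right_diff_distrib)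

lemma seminorm_Cauchy_uminus: "seminorm_Cauchy s \<Longrightarrow> seminorm_Cauchy (\<lambda>n. - s n)"
  using seminorm_Cauchy_scalar[of s "- 1"] by (simp add: scalar_uminus)

lemma seminorm_Cauchy_adj: "seminorm_Cauchy s \<Longrightarrow> seminorm_Cauchy (\<lambda>n. adj (s n))"
  by (rule seminorm_CauchyI[of s s 1 0]) (simp_all add: seminorm_adj flip: adj_diff)

lemma Cauchy_seminorm:
  assumes "seminorm_Cauchy s"
  shows "Cauchy (\<lambda>n. seminorm (s n))"
proof (rule metric_CauchyI)
  fix e :: real assume "e > 0"
  then obtain N where N: "\<And>m n. m \<ge> N \<Longrightarrow> n \<ge> N \<Longrightarrow> seminorm (s m - s n) < e"
    using assms unfolding seminorm_Cauchy_def by meson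
  have "dist (seminorm (s m)) (seminorm (s n)) < e" if "m \<ge> N" "n \<ge> N" for m n
    using seminorm_diff_le[of "s m" "s n"] N[OF that] by (simp add: dist_real_def)
  then show "\<exists>N. \<forall>m\<ge>N. \<forall>n\<ge>N. dist (seminorm (s m)) (seminorm (s n)) < e"
    by blast
qed

lemma seminorm_Cauchy_bounded:
  assumes "seminorm_Cauchy s"
  obtains B where "0 \<le> B" "\<And>n. seminorm (s n) \<le> B"
proof -
  obtain B where B: "\<And>n. norm (seminorm (s n)) \<le> B"
    using Cauchy_Bseq[OF Cauchy_seminorm[OF assms]] by (auto simp: Bseq_def)
  then have "seminorm (s n) \<le> B" for n
    by (metis abs_le_D1 real_norm_def)
  with seminorm_nonneg[of "s 0"] show thesis
    by (intro that[of B]) (auto intro: order_trans)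
qed

lemma seminorm_Cauchy_mult:
  assumes s: "seminorm_Cauchy s" and t: "seminorm_Cauchy t"
  shows "seminorm_Cauchy (\<lambda>n. s n * t n)"
proof -
  obtain A where A: "0 \<le> A" "\<And>n. seminorm (s n) \<le> A"
    using seminorm_Cauchy_bounded[OF s] by blast
  obtain B where B: "0 \<le> B" "\<And>n. seminorm (t n) \<le> B"
    using seminorm_Cauchy_bounded[OF t] by blast
  show ?thesis
  proof (rule seminorm_CauchyI[OF s t])
    fix m n
    have "s m * t m - s n * t n = (s m - s n) * t m + s n * (t m - t n)"
      by (simp add: algebra_simps)
    then have "seminorm (s m * t m - s n * t n)
        \<le> seminorm ((s m - s n) * t m) + seminorm (s n * (t m - t n))"
      using seminorm_add by simp
    also have "\<dots> \<le> seminorm (s m - s n) * seminorm (t m) + seminorm (s n) * seminorm (t m - t n)"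
      by (intro add_mono seminorm_mult)
    also have "\<dots> \<le> seminorm (s m - s n) * B + A * seminorm (t m - t n)"
      using A B by (intro add_mono mult_mono) (auto intro: seminorm_nonneg)
    finally show "seminorm (s m * t m - s n * t n)
        \<le> B * seminorm (s m - s n) + A * seminorm (t m - t n)"
      by (simp add: mult.commute)
  qed (use A B in auto)
qed

text \<open>By \<open>norm_ip_mult_le\<close> every coefficient sequence is Cauchy in B, which is
  complete.\<close>

lemma seminorm_Cauchy_represents:
  assumes "seminorm_Cauchy s"
  shows "\<exists>T. represents s T"
proof -
  have "convergent (\<lambda>n. ip (gen a) (s n * gen b))" for a b
  proof (rule Cauchy_convergent, rule CauchyI)
    fix e :: real assume "e > 0"
    define M where "M = 3 * (norm (ip (gen a) (gen a)) + norm (ip (gen b) (gen b))) + 1"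
    have "M > 0" by (simp add: M_def add_nonneg_pos)
    with \<open>e > 0\<close> have "e / M > 0" by simp
    then obtain N where N: "\<And>m n. m \<ge> N \<Longrightarrow> n \<ge> N \<Longrightarrow> seminorm (s m - s n) < e / M"
      using assms unfolding seminorm_Cauchy_def by meson
    have "norm (ip (gen a) (s m * gen b) - ip (gen a) (s n * gen b)) < e" if "m \<ge> N" "n \<ge> N" for m n
    proof -
      have "norm (ip (gen a) (s m * gen b) - ip (gen a) (s n * gen b))
          = norm (ip (gen a) ((s m - s n) * gen b))"
        by (simp add: left_diff_distrib ip_diff_right)
      also have "\<dots> \<le> (M - 1) * seminorm (s m - s n)"
        using norm_ip_mult_le[of "gen a" "s m - s n" "gen b"] by (simp add: M_def)
      also have "\<dots> \<le> M * seminorm (s m - s n)"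
        by (intro mult_right_mono seminorm_nonneg) simp
      also have "\<dots> < e"
        using N[OF that] \<open>M > 0\<close> by (simp add: pos_less_divide_eq mult.commute)
      finally show ?thesis .
    qed
    then show "\<exists>N. \<forall>m\<ge>N. \<forall>n\<ge>N. norm (ip (gen a) (s m * gen b) - ip (gen a) (s n * gen b)) < e"
      by blast
  qed
  then have "represents s (\<lambda>a b. lim (\<lambda>n. ip (gen a) (s n * gen b)))"
    using assms by (simp add: represents_def convergent_LIMSEQ_iff)
  then show ?thesis by blast
qed

text \<open>The form is sesquilinear and generators span, so convergence of the coefficients at
  generators suffices.\<close>

lemma tendsto_ip_zero:
  assumes "\<And>a b. (\<lambda>n. ip (gen a) (s n * gen b)) \<longlonglongrightarrow> 0"
  shows "(\<lambda>n. ip g (s n * h)) \<longlonglongrightarrow> 0"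
proof -
  have *: "(\<lambda>n. ip (gen a) (s n * h)) \<longlonglongrightarrow> 0" for a
  proof (induction h rule: monoid_algebra_induct)
    case (add c b h)
    have "(\<lambda>n. c *\<^sub>C ip (gen a) (s n * gen b)) \<longlonglongrightarrow> 0"
    proof (rule tendsto_norm_zero_cancel)
      show "(\<lambda>n. norm (c *\<^sub>C ip (gen a) (s n * gen b))) \<longlonglongrightarrow> 0"
        using tendsto_mult_right_zero[OF tendsto_norm_zero[OF assms[of a b]], of "cmod c"]
        by (simp add: norm_scaleC)
    qed
    from tendsto_add[OF this add] show ?case
      by (simp add: distrib_left ip_add_right scalar_left_commute ip_scalar_right)
  qed simp
  show ?thesis
  proof (induction g rule: monoid_algebra_induct)
    case (add c a g)
    have "(\<lambda>n. cnj c *\<^sub>C ip (gen a) (s n * h)) \<longlonglongrightarrow> 0"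
    proof (rule tendsto_norm_zero_cancel)
      show "(\<lambda>n. norm (cnj c *\<^sub>C ip (gen a) (s n * h))) \<longlonglongrightarrow> 0"
        using tendsto_mult_right_zero[OF tendsto_norm_zero[OF *[of a]], of "cmod c"]
        by (simp add: norm_scaleC)
    qed
    from tendsto_add[OF this add] show ?case
      by (simp add: ip_add_left ip_scalar_left)
  qed simp
qed

text \<open>The encoding by functions is faithful. For large m and n the form at (s m - s n) g is at
  most (e/2)^2 <g, g>. Discard the positive term <s n g, s n g> and let n tend to infinity: the
  mixed terms vanish, and closedness of the cone leaves e/2 as a bound for s m.\<close>

lemma represents_zero_seminorm:
  assumes s: "represents s (\<lambda>a b. 0)"
  shows "(\<lambda>n. seminorm (s n)) \<longlonglongrightarrow> 0"
proof (rule LIMSEQ_I)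
  fix e :: real assume "e > 0"
  then obtain N where N: "\<And>m n. m \<ge> N \<Longrightarrow> n \<ge> N \<Longrightarrow> seminorm (s m - s n) < e / 2"
    using representsD(1)[OF s] unfolding seminorm_Cauchy_def by (meson half_gt_zero)
  have "left_bound (s m) (e / 2)" if "m \<ge> N" for m
    unfolding left_bound_def
  proof (intro conjI allI)
    show "e / 2 > 0" using \<open>e > 0\<close> by simp
    fix g
    let ?A = "(e / 2)\<^sup>2 *\<^sub>R ip g g - ip (s m * g) (s m * g)"
    let ?x = "\<lambda>n. ip (s m * g) (s (n + N) * g)"
    show "psd ?A"
    proof (rule psd_closed)
      show "psd (?A + (?x n + star (?x n)))" for n
      proof -
        let ?d = "s m - s (n + N)"
        have "psd (((e / 2)\<^sup>2 *\<^sub>R ip g g - ip (?d * g) (?d * g)) + ip (s (n + N) * g) (s (n + N) * g))"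
          using N[of m "n + N"] that
          by (intro psd_add left_boundD left_bound_of_seminorm ip_psd) simp
        then show ?thesis
          by (simp add: left_diff_distrib ip_bilinear ip_hermitian algebra_simps)
      qed
      have "(\<lambda>n. ip (s m * g) (s n * g)) \<longlonglongrightarrow> 0"
        by (rule tendsto_ip_zero) (rule representsD(2)[OF s])
      then have "?x \<longlonglongrightarrow> 0"
        by (rule LIMSEQ_ignore_initial_segment)
      from tendsto_add[OF tendsto_const tendsto_add[OF this tendsto_star[OF this]]]
      show "(\<lambda>n. ?A + (?x n + star (?x n))) \<longlonglongrightarrow> ?A"
        by fastforce
    qed
  qed
  then have "seminorm (s m) < e" if "m \<ge> N" for m
    using seminorm_le that \<open>e > 0\<close> by fastforce
  then show "\<exists>N. \<forall>n\<ge>N. norm (seminorm (s n) - 0) < e"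
    using seminorm_nonneg by auto
qed

lemma represents_add:
  "represents s S \<Longrightarrow> represents t T \<Longrightarrow> represents (\<lambda>n. s n + t n) (\<lambda>a b. S a b + T a b)"
  unfolding represents_def
  by (auto simp: distrib_right ip_add_right intro!: seminorm_Cauchy_add tendsto_add)

lemma represents_scalar:
  assumes "represents s T"
  shows "represents (\<lambda>n. scalar c * s n) (\<lambda>a b. c *\<^sub>C T a b)"
proof -
  have "(\<lambda>n. c *\<^sub>C ip (gen a) (s n * gen b)) \<longlonglongrightarrow> c *\<^sub>C T a b" for a b
  proof -
    have "(\<lambda>n. norm (c *\<^sub>C (ip (gen a) (s n * gen b) - T a b))) \<longlonglongrightarrow> 0"
      unfolding norm_scaleC
      by (intro tendsto_mult_right_zero tendsto_norm_zero LIM_zero representsD(2) assms)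
    then show ?thesis
      by (simp add: scaleC.scale_right_diff_distrib LIM_zero_iff tendsto_norm_zero_iff)
  qed
  then show ?thesis
    using seminorm_Cauchy_scalar representsD(1)[OF assms]
    by (simp add: represents_def mult.assoc ip_scalar_right)
qed

lemma represents_uminus: "represents s T \<Longrightarrow> represents (\<lambda>n. - s n) (\<lambda>a b. - T a b)"
  unfolding represents_def
  by (auto simp: ip_uminus_right intro!: seminorm_Cauchy_uminus tendsto_minus)

lemma represents_diff:
  "represents s S \<Longrightarrow> represents t T \<Longrightarrow> represents (\<lambda>n. s n - t n) (\<lambda>a b. S a b - T a b)"
  using represents_add[OF _ represents_uminus] by fastforce

lemma represents_adj:
  assumes "represents s T"
  shows "represents (\<lambda>n. adj (s n)) (\<lambda>a b. star (T b a))"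
proof -
  have "ip (gen a) (adj (s n) * gen b) = star (ip (gen b) (s n * gen a))" for a b n
    by (simp add: ip_hermitian ip_mult_left)
  then show ?thesis
    using assms unfolding represents_def by (simp add: seminorm_Cauchy_adj tendsto_star)
qed

definition embed :: "'a monoid_algebra \<Rightarrow> 'a \<Rightarrow> 'a \<Rightarrow> 'b"
  where "embed f a b = ip (gen a) (f * gen b)"

lemma represents_embed: "represents (\<lambda>n. f) (embed f)"
  by (simp add: represents_def seminorm_Cauchy_const embed_def)

lemma represents_same_limit:
  assumes "represents s T" "represents t T"
  shows "(\<lambda>n. seminorm (s n - t n)) \<longlonglongrightarrow> 0"
  using represents_diff[OF assms] by (intro represents_zero_seminorm) simp

section \<open>The C*-algebra of represented functions\<close>

definition rep_seq :: "('a \<Rightarrow> 'a \<Rightarrow> 'b) \<Rightarrow> nat \<Rightarrow> 'a monoid_algebra"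
  where "rep_seq T = (SOME s. represents s T)"

lemma represents_rep_seq: "represents s T \<Longrightarrow> represents (rep_seq T) T"
  unfolding rep_seq_def by (rule someI[where P = "\<lambda>s. represents s T"])

text \<open>Linear operations and the involution are read off the functions; the involution swaps
  the arguments because the form is hermitian. Product and norm go through chosen representing
  sequences, and the next lemmas show that the choice does not matter.\<close>

definition completion :: "('a \<Rightarrow> 'a \<Rightarrow> 'b) cstar_structure"
  where "completion = \<lparr>carrier = {T. \<exists>s. represents s T},
    mult = \<lambda>S T. SOME U. represents (\<lambda>n. rep_seq S n * rep_seq T n) U,
    one = embed 1, zero = \<lambda>a b. 0, add = \<lambda>S T a b. S a b + T a b,
    cscale = \<lambda>c T a b. c *\<^sub>C T a b, cstar = \<lambda>T a b. star (T b a),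
    cnorm = \<lambda>T. lim (\<lambda>n. seminorm (rep_seq T n))\<rparr>"

lemma completion_simps [simp]:
  "carrier completion = {T. \<exists>s. represents s T}"
  "one completion = embed 1"
  "zero completion = (\<lambda>a b. 0)"
  "add completion S T = (\<lambda>a b. S a b + T a b)"
  "cscale completion c T = (\<lambda>a b. c *\<^sub>C T a b)"
  "cstar completion T = (\<lambda>a b. star (T b a))"
  by (simp_all add: completion_def)

text \<open>Two representing sequences of the same function differ by a null sequence, and s t - s'
  t' = (s - s') t + s' (t - t') with bounded factors is then null as well. Null sequences have
  coefficients that tend to 0.\<close>

lemma represents_mult:
  assumes s: "represents s S" and t: "represents t T"
  shows "represents (\<lambda>n. s n * t n) (S \<otimes>\<^bsub>completion\<^esub> T)"
proof -
  let ?s = "rep_seq S" and ?t = "rep_seq T"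
  have s': "represents ?s S" and t': "represents ?t T"
    using s t by (auto intro: represents_rep_seq)
  have "\<exists>U. represents (\<lambda>n. ?s n * ?t n) U"
    by (intro seminorm_Cauchy_represents seminorm_Cauchy_mult representsD(1)[OF s'] representsD(1)[OF t'])
  from someI_ex[OF this] have U': "represents (\<lambda>n. ?s n * ?t n) (S \<otimes>\<^bsub>completion\<^esub> T)"
    by (simp add: completion_def)
  obtain U where U: "represents (\<lambda>n. s n * t n) U"
    using seminorm_Cauchy_represents[OF seminorm_Cauchy_mult[OF representsD(1)[OF s] representsD(1)[OF t]]]
    by blast
  obtain A where A: "\<And>n. seminorm (?s n) \<le> A"
    using seminorm_Cauchy_bounded[OF representsD(1)[OF s']] by blast
  obtain B where B: "\<And>n. seminorm (t n) \<le> B"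
    using seminorm_Cauchy_bounded[OF representsD(1)[OF t]] by blast
  have le: "seminorm (s n * t n - ?s n * ?t n) \<le> seminorm (s n - ?s n) * B + A * seminorm (t n - ?t n)" for n
  proof -
    have "s n * t n - ?s n * ?t n = (s n - ?s n) * t n + ?s n * (t n - ?t n)"
      by (simp add: algebra_simps)
    then have "seminorm (s n * t n - ?s n * ?t n)
        \<le> seminorm ((s n - ?s n) * t n) + seminorm (?s n * (t n - ?t n))"
      using seminorm_add by simp
    also have "\<dots> \<le> seminorm (s n - ?s n) * seminorm (t n) + seminorm (?s n) * seminorm (t n - ?t n)"
      by (intro add_mono seminorm_mult)
    also have "\<dots> \<le> seminorm (s n - ?s n) * B + A * seminorm (t n - ?t n)"
      by (intro add_mono mult_left_mono mult_right_mono A B seminorm_nonneg)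
    finally show ?thesis .
  qed
  have "(\<lambda>n. seminorm (s n - ?s n) * B + A * seminorm (t n - ?t n)) \<longlonglongrightarrow> 0"
    by (intro tendsto_add_zero tendsto_mult_left_zero tendsto_mult_right_zero
        represents_same_limit[OF s s'] represents_same_limit[OF t t'])
  then have null: "(\<lambda>n. seminorm (s n * t n - ?s n * ?t n)) \<longlonglongrightarrow> 0"
    by (rule null_sequence_comparison) (simp add: le seminorm_nonneg)
  have "U a b = (S \<otimes>\<^bsub>completion\<^esub> T) a b" for a b
  proof -
    let ?x = "\<lambda>n. ip (gen a) ((s n * t n - ?s n * ?t n) * gen b)"
    have "?x \<longlonglongrightarrow> 0"
      by (rule null_sequence_comparison[OF tendsto_mult_right_zero[OF null] norm_ip_mult_le])
    moreover have "?x \<longlonglongrightarrow> U a b - (S \<otimes>\<^bsub>completion\<^esub> T) a b"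
      using tendsto_diff[OF representsD(2)[OF U] representsD(2)[OF U'], of a b a b]
      by (simp add: left_diff_distrib ip_diff_right)
    ultimately show ?thesis
      using LIMSEQ_unique by fastforce
  qed
  then have "U = S \<otimes>\<^bsub>completion\<^esub> T"
    by (intro ext)
  with U show ?thesis by simp
qed

lemma represents_cnorm:
  assumes s: "represents s T"
  shows "(\<lambda>n. seminorm (s n)) \<longlonglongrightarrow> cnorm completion T"
proof -
  have r: "represents (rep_seq T) T"
    using s by (rule represents_rep_seq)
  have "(\<lambda>n. seminorm (rep_seq T n)) \<longlonglongrightarrow> cnorm completion T"
    using Cauchy_convergent[OF Cauchy_seminorm[OF representsD(1)[OF r]]]
    by (simp add: completion_def convergent_LIMSEQ_iff)
  moreover have "(\<lambda>n. seminorm (s n) - seminorm (rep_seq T n)) \<longlonglongrightarrow> 0"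
    by (rule null_sequence_comparison[OF represents_same_limit[OF s r]]) (simp add: seminorm_diff_le)
  ultimately show ?thesis
    using tendsto_add by fastforce
qed

lemma cnorm_completion_nonneg:
  assumes "represents s T"
  shows "0 \<le> cnorm completion T"
  by (rule LIMSEQ_le_const[OF represents_cnorm[OF assms]]) (simp add: seminorm_nonneg)

lemma cnorm_completion_le_add:
  assumes "represents s S" "represents t T" "represents u U"
    and "\<And>n. seminorm (s n) \<le> seminorm (t n) + seminorm (u n)"
  shows "cnorm completion S \<le> cnorm completion T + cnorm completion U"
  using assms(4) by (intro LIMSEQ_le[OF represents_cnorm[OF assms(1)]
        tendsto_add[OF represents_cnorm[OF assms(2)] represents_cnorm[OF assms(3)]]]) auto

text \<open>Axioms involving products hold for representing sequences, term by term in the monoid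
  algebra, and pass to functions by \<open>represents_unique\<close>.\<close>

lemma completion_ring: "ring completion"
proof (rule ringI)
  show "abelian_group completion"
  proof (rule abelian_groupI)
    fix S T assume "S \<in> carrier completion" "T \<in> carrier completion"
    then obtain s t where "represents s S" "represents t T" by auto
    from represents_add[OF this] show "S \<oplus>\<^bsub>completion\<^esub> T \<in> carrier completion"
      by auto
  next
    show "\<zero>\<^bsub>completion\<^esub> \<in> carrier completion"
      using represents_embed[of 0] by (auto simp: embed_def[abs_def])
  next
    fix T assume "T \<in> carrier completion"
    then show "\<exists>S\<in>carrier completion. S \<oplus>\<^bsub>completion\<^esub> T = \<zero>\<^bsub>completion\<^esub>"
      using represents_uminus by (intro bexI[of _ "\<lambda>a b. - T a b"]) auto
  qed (auto simp: add_ac)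
next
  show "monoid completion"
  proof (rule monoidI)
    fix S T assume "S \<in> carrier completion" "T \<in> carrier completion"
    then obtain s t where "represents s S" "represents t T" by auto
    from represents_mult[OF this] show "S \<otimes>\<^bsub>completion\<^esub> T \<in> carrier completion"
      by auto
  next
    show "\<one>\<^bsub>completion\<^esub> \<in> carrier completion"
      using represents_embed by auto
  next
    fix S T U
    assume "S \<in> carrier completion" "T \<in> carrier completion" "U \<in> carrier completion"
    then obtain s t u where r: "represents s S" "represents t T" "represents u U" by auto
    show "S \<otimes>\<^bsub>completion\<^esub> T \<otimes>\<^bsub>completion\<^esub> U = S \<otimes>\<^bsub>completion\<^esub> (T \<otimes>\<^bsub>completion\<^esub> U)"
      using represents_mult[OF represents_mult[OF r(1,2)] r(3)]
        represents_mult[OF r(1) represents_mult[OF r(2,3)]]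
      by (intro represents_unique) (simp_all add: mult.assoc)
  next
    fix T assume "T \<in> carrier completion"
    then obtain t where t: "represents t T" by auto
    show "\<one>\<^bsub>completion\<^esub> \<otimes>\<^bsub>completion\<^esub> T = T"
      using represents_mult[OF represents_embed[of 1] t] t by (intro represents_unique) simp_all
    show "T \<otimes>\<^bsub>completion\<^esub> \<one>\<^bsub>completion\<^esub> = T"
      using represents_mult[OF t represents_embed[of 1]] t by (intro represents_unique) simp_all
  qed
next
  fix S T U
  assume "S \<in> carrier completion" "T \<in> carrier completion" "U \<in> carrier completion"
  then obtain s t u where r: "represents s S" "represents t T" "represents u U" by auto
  show "(S \<oplus>\<^bsub>completion\<^esub> T) \<otimes>\<^bsub>completion\<^esub> U
      = S \<otimes>\<^bsub>completion\<^esub> U \<oplus>\<^bsub>completion\<^esub> T \<otimes>\<^bsub>completion\<^esub> U"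
    using represents_mult[OF represents_add[OF r(1,2)] r(3)]
      represents_add[OF represents_mult[OF r(1,3)] represents_mult[OF r(2,3)]]
    by (intro represents_unique) (simp_all add: distrib_right)
  show "U \<otimes>\<^bsub>completion\<^esub> (S \<oplus>\<^bsub>completion\<^esub> T)
      = U \<otimes>\<^bsub>completion\<^esub> S \<oplus>\<^bsub>completion\<^esub> U \<otimes>\<^bsub>completion\<^esub> T"
    using represents_mult[OF r(3) represents_add[OF r(1,2)]]
      represents_add[OF represents_mult[OF r(3,1)] represents_mult[OF r(3,2)]]
    by (intro represents_unique) (simp_all add: distrib_left)
qed

lemma completion_minus:
  assumes "S \<in> carrier completion" "T \<in> carrier completion"
  shows "S \<ominus>\<^bsub>completion\<^esub> T = (\<lambda>a b. S a b - T a b)"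
proof -
  interpret ring completion by (rule completion_ring)
  have "\<ominus>\<^bsub>completion\<^esub> T = (\<lambda>a b. - T a b)"
    using assms represents_uminus by (intro minus_equality) auto
  then show ?thesis by (simp add: a_minus_def)
qed

text \<open>Approximate each \<open>S n\<close> within 1 / (n + 1) by an element \<open>f n\<close>
  of the monoid algebra. These form a Cauchy sequence, and the function that it represents is the
  limit.\<close>

lemma completion_complete:
  fixes S :: "nat \<Rightarrow> 'a \<Rightarrow> 'a \<Rightarrow> 'b"
  assumes S: "\<And>n. S n \<in> carrier completion"
    and Cauchy: "\<And>e. e > 0 \<Longrightarrow> \<exists>N. \<forall>m\<ge>N. \<forall>n\<ge>N. cnorm completion (S m \<ominus>\<^bsub>completion\<^esub> S n) < e"
  shows "\<exists>L\<in>carrier completion. (\<lambda>n. cnorm completion (S n \<ominus>\<^bsub>completion\<^esub> L)) \<longlonglongrightarrow> 0"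
proof -
  let ?d = "\<lambda>S T. cnorm completion (\<lambda>a b. S a b - T a b)"
  have rep: "\<exists>s. represents s (S n)" for n
    using S[of n] by simp
  have triangle: "?d T V \<le> ?d T U + ?d U V" if "represents t T" "represents u U" "represents v V"
    for t u v T U V
    using that by (intro cnorm_completion_le_add[OF represents_diff represents_diff represents_diff])
      (auto intro: seminorm_diff_triangle)
  have d_commute: "?d T U = ?d U T" if "represents t T" "represents u U" for t u T U
    using represents_cnorm[OF represents_diff[OF that]]
      represents_cnorm[OF represents_diff[OF that(2,1)]]
    by (simp add: seminorm_minus_commute[of "t _"] LIMSEQ_unique)
  have "\<exists>f. ?d (S n) (embed f) < 1 / real (Suc n)" for n
  proof -
    obtain s where s: "represents s (S n)" using rep by blast
    obtain N where N: "\<And>m k. m \<ge> N \<Longrightarrow> k \<ge> N \<Longrightarrow> seminorm (s m - s k) < 1 / real (Suc n) / 2"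
      using representsD(1)[OF s] unfolding seminorm_Cauchy_def
      by (meson half_gt_zero of_nat_0_less_iff zero_less_Suc zero_less_divide_1_iff)
    \<comment> \<open>The strict bound becomes weak in the limit, hence the additional factor
      1/2.\<close>
    have "?d (S n) (embed (s N)) \<le> 1 / real (Suc n) / 2"
      using N by (intro LIMSEQ_le_const2[OF represents_cnorm[OF represents_diff[OF s represents_embed]]]
          exI[of _ N]) (simp add: less_imp_le)
    also have "\<dots> < 1 / real (Suc n)"
      by (simp add: field_simps)
    finally show ?thesis by blast
  qed
  then obtain f where f: "\<And>n. ?d (S n) (embed (f n)) < 1 / real (Suc n)"
    by metis
  have embed_dist: "?d (embed g) (embed h) = seminorm (g - h)" for g h
    using LIMSEQ_unique[OF represents_cnorm[OF represents_diff[OF represents_embed represents_embed]] tendsto_const]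
    by simp
  have "seminorm_Cauchy f"
    unfolding seminorm_Cauchy_def
  proof (intro allI impI)
    fix e :: real assume "e > 0"
    then obtain M where M: "\<And>m n. m \<ge> M \<Longrightarrow> n \<ge> M \<Longrightarrow> ?d (S m) (S n) < e / 3"
      using Cauchy[of "e / 3"] by (auto simp: completion_minus[OF S S])
    obtain K where K: "1 / real (Suc K) < e / 3"
      using \<open>e > 0\<close> reals_Archimedean[of "e / 3"] by (auto simp: inverse_eq_divide)
    have small: "1 / real (Suc n) < e / 3" if "n \<ge> K" for n
      using that K by (intro le_less_trans[OF _ K]) (simp add: frac_le)
    have "seminorm (f m - f n) < e" if "m \<ge> max M K" "n \<ge> max M K" for m n
    proof -
      obtain s t where st: "represents s (S m)" "represents t (S n)" using rep by blast
      have "seminorm (f m - f n) \<le> ?d (embed (f m)) (S m) + ?d (S m) (embed (f n))"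
        using triangle[OF represents_embed st(1) represents_embed, of "f m" "f n"]
        by (simp add: embed_dist)
      also have "\<dots> \<le> ?d (S m) (embed (f m)) + (?d (S m) (S n) + ?d (S n) (embed (f n)))"
        using triangle[OF st represents_embed, of "f n"] d_commute[OF st(1) represents_embed, of "f m"]
        by simp
      also have "\<dots> < e"
        using f[of m] f[of n] small[of m] small[of n] M[of m n] that by simp
      finally show ?thesis .
    qed
    then show "\<exists>N. \<forall>m\<ge>N. \<forall>n\<ge>N. seminorm (f m - f n) < e" by blast
  qed
  then obtain L where L: "represents f L"
    using seminorm_Cauchy_represents by blast
  \<comment> \<open>The distance is the limit over k of \<open>seminorm (f n - f k)\<close>.\<close>
  have "(\<lambda>n. ?d (embed (f n)) L) \<longlonglongrightarrow> 0"
  proof (rule LIMSEQ_I)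
    fix e :: real assume "e > 0"
    then obtain N where N: "\<And>m n. m \<ge> N \<Longrightarrow> n \<ge> N \<Longrightarrow> seminorm (f m - f n) < e / 2"
      using representsD(1)[OF L] unfolding seminorm_Cauchy_def by (meson half_gt_zero)
    have "norm (?d (embed (f n)) L - 0) < e" if "n \<ge> N" for n
    proof -
      note lim = represents_cnorm[OF represents_diff[OF represents_embed L], of "f n"]
      have "?d (embed (f n)) L \<le> e / 2"
        using N[OF that] by (intro LIMSEQ_le_const2[OF lim] exI[of _ N]) (simp add: less_imp_le)
      moreover have "0 \<le> ?d (embed (f n)) L"
        by (rule cnorm_completion_nonneg[OF represents_diff[OF represents_embed L]])
      ultimately show ?thesis using \<open>e > 0\<close> by simp
    qed
    then show "\<exists>N. \<forall>n\<ge>N. norm (?d (embed (f n)) L - 0) < e" by blast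
  qed
  then have upper: "(\<lambda>n. 1 / real (Suc n) + ?d (embed (f n)) L) \<longlonglongrightarrow> 0"
    by (intro tendsto_add_zero LIMSEQ_Suc lim_1_over_n)
  have "(\<lambda>n. ?d (S n) L) \<longlonglongrightarrow> 0"
  proof (rule null_sequence_comparison[OF upper])
    fix n
    obtain s where s: "represents s (S n)" using rep by blast
    have "0 \<le> ?d (S n) L"
      by (rule cnorm_completion_nonneg[OF represents_diff[OF s L]])
    then show "norm (?d (S n) L) \<le> 1 / real (Suc n) + ?d (embed (f n)) L"
      using triangle[OF s represents_embed L, of "f n"] f[of n] by simp
  qed
  moreover have "L \<in> carrier completion"
    using L by auto
  ultimately show ?thesis
    using completion_minus[OF S] by auto
qed

lemma completion_cstar_structure: "unital_cstar_structure completion"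
proof (intro unital_cstar_structure.intro completion_ring unital_cstar_structure_axioms.intro)
  fix T assume "T \<in> carrier completion"
  then obtain t where t: "represents t T" by auto
  show "cscale completion c T \<in> carrier completion" for c
    using represents_scalar[OF t] by auto
  show "cscale completion (c + d) T = cscale completion c T \<oplus>\<^bsub>completion\<^esub> cscale completion d T" for c d
    by (simp add: scaleC_add_left)
  show "cscale completion c (cscale completion d T) = cscale completion (c * d) T" for c d
    by (simp add: scaleC_scaleC)
  show "cscale completion 1 T = T"
    by simp
  show "0 \<le> cnorm completion T"
    by (rule cnorm_completion_nonneg[OF t])
  show "cnorm completion T = 0 \<longleftrightarrow> T = \<zero>\<^bsub>completion\<^esub>"
  proof
    assume zero: "cnorm completion T = 0"
    \<comment> \<open>The norm dominates all coefficients; the converse direction is the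
      faithfulness of the encoding.\<close>
    have "T a b = 0" for a b
    proof (rule LIMSEQ_unique[OF representsD(2)[OF t]])
      have "(\<lambda>n. 3 * (norm (ip (gen a) (gen a)) + norm (ip (gen b) (gen b))) * seminorm (t n)) \<longlonglongrightarrow> 0"
        using represents_cnorm[OF t] unfolding zero by (rule tendsto_mult_right_zero)
      then show "(\<lambda>n. ip (gen a) (t n * gen b)) \<longlonglongrightarrow> 0"
        by (rule null_sequence_comparison) (rule norm_ip_mult_le)
    qed
    then show "T = \<zero>\<^bsub>completion\<^esub>" by (simp add: fun_eq_iff)
  next
    assume "T = \<zero>\<^bsub>completion\<^esub>"
    with t have "(\<lambda>n. seminorm (t n)) \<longlonglongrightarrow> 0"
      by (intro represents_zero_seminorm) simp
    with represents_cnorm[OF t] show "cnorm completion T = 0"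
      by (rule LIMSEQ_unique)
  qed
  show "cnorm completion (cscale completion c T) = cmod c * cnorm completion T" for c
    using represents_cnorm[OF represents_scalar[OF t], of c]
      tendsto_mult_left[OF represents_cnorm[OF t], of "cmod c"]
    by (simp add: seminorm_scalar LIMSEQ_unique)
  show "cstar completion T \<in> carrier completion"
    using represents_adj[OF t] by auto
  show "cstar completion (cscale completion c T) = cscale completion (cnj c) (cstar completion T)" for c
    by (simp add: star_scaleC)
  show "cstar completion (cstar completion T) = T"
    by (simp add: star_star)
  show "cnorm completion (cstar completion T \<otimes>\<^bsub>completion\<^esub> T) = (cnorm completion T)\<^sup>2"
    using represents_cnorm[OF represents_mult[OF represents_adj[OF t] t]]
      tendsto_power[OF represents_cnorm[OF t], of 2]
    by (simp add: seminorm_adj_mult LIMSEQ_unique)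
next
  fix S T assume "S \<in> carrier completion" "T \<in> carrier completion"
  then obtain s t where s: "represents s S" and t: "represents t T" by auto
  show "cscale completion c (S \<oplus>\<^bsub>completion\<^esub> T)
      = cscale completion c S \<oplus>\<^bsub>completion\<^esub> cscale completion c T" for c
    by (simp add: scaleC_add_right)
  show "cscale completion c S \<otimes>\<^bsub>completion\<^esub> T = cscale completion c (S \<otimes>\<^bsub>completion\<^esub> T)" for c
    using represents_mult[OF represents_scalar[OF s] t] represents_scalar[OF represents_mult[OF s t]]
    by (intro represents_unique) (simp_all add: mult.assoc)
  show "S \<otimes>\<^bsub>completion\<^esub> cscale completion c T = cscale completion c (S \<otimes>\<^bsub>completion\<^esub> T)" for c
    using represents_mult[OF s represents_scalar[OF t]] represents_scalar[OF represents_mult[OF s t]]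
    by (intro represents_unique) (simp_all add: scalar_left_commute)
  show "cnorm completion (S \<oplus>\<^bsub>completion\<^esub> T) \<le> cnorm completion S + cnorm completion T"
    using cnorm_completion_le_add[OF represents_add[OF s t] s t] by (simp add: seminorm_add)
  show "cnorm completion (S \<otimes>\<^bsub>completion\<^esub> T) \<le> cnorm completion S * cnorm completion T"
    using seminorm_mult by (intro LIMSEQ_le[OF represents_cnorm[OF represents_mult[OF s t]]
          tendsto_mult[OF represents_cnorm[OF s] represents_cnorm[OF t]]]) auto
  show "cstar completion (S \<oplus>\<^bsub>completion\<^esub> T) = cstar completion S \<oplus>\<^bsub>completion\<^esub> cstar completion T"
    by (simp add: star_add)
  show "cstar completion (S \<otimes>\<^bsub>completion\<^esub> T) = cstar completion T \<otimes>\<^bsub>completion\<^esub> cstar completion S"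
    using represents_adj[OF represents_mult[OF s t]]
      represents_mult[OF represents_adj[OF t] represents_adj[OF s]]
    by (intro represents_unique) (simp_all add: adj_mult)
qed (rule completion_complete)

text \<open>Since \<open>gen 1\<close> is the unit, evaluation at (1, 1) sends the function
  represented by s to the limit of the linear extension of \<phi> along s.\<close>

lemma factorization:
  "unital_cstar_structure completion"
  "star_multiplicative_into completion (\<lambda>a. embed (gen a))"
  "positive_linear_from completion (\<lambda>T. T 1 1)"
  "\<phi> = (\<lambda>T. T 1 1) \<circ> (\<lambda>a. embed (gen a))"
proof -
  show "unital_cstar_structure completion" by (rule completion_cstar_structure)
  show "star_multiplicative_into completion (\<lambda>a. embed (gen a))"
    unfolding star_multiplicative_into_def
  proof (intro conjI allI)
    fix a b :: 'a
    show "embed (gen a) \<in> carrier completion"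
      using represents_embed by auto
    show "embed (gen (a * b)) = embed (gen a) \<otimes>\<^bsub>completion\<^esub> embed (gen b)"
      using represents_mult[OF represents_embed[of "gen a"] represents_embed[of "gen b"]]
      by (intro represents_unique[OF represents_embed]) (simp add: gen_mult)
    show "embed (gen (star a)) = cstar completion (embed (gen a))"
      using represents_adj[OF represents_embed[of "gen a"]]
      by (intro represents_unique[OF represents_embed]) (simp add: adj_gen)
  qed
  show "positive_linear_from completion (\<lambda>T. T 1 1)"
    unfolding positive_linear_from_def
  proof (intro conjI ballI allI impI)
    fix T assume "positive_in completion T"
    then obtain S s where s: "represents s S" and T: "T = cstar completion S \<otimes>\<^bsub>completion\<^esub> S"
      by (auto simp: positive_in_def)
    \<comment> \<open>A square in the completion evaluates to a limit of diagonal values of the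
      form, which lie in the closed positive cone.\<close>
    have "(\<lambda>n. ip (s n) (s n)) \<longlonglongrightarrow> T 1 1"
      using representsD(2)[OF represents_mult[OF represents_adj[OF s] s], of 1 1]
      by (simp add: T gen_one ip_def)
    then show "cstar_positive (T 1 1)"
      unfolding cstar_positive_iff_psd by (rule psd_closed) (rule ip_psd)
  qed simp_all
  show "\<phi> = (\<lambda>T. T 1 1) \<circ> (\<lambda>a. embed (gen a))"
    using ip_gen[of 1 _ 1] by (simp add: fun_eq_iff embed_def)
qed

end

text \<open>The existential needs a fixed carrier type: \<open>'a => 'a => 'b\<close> holds the
  completion, and the second conjunct shows that factorizing through a C on any other type
  \<open>'c\<close> also implies bounded positivity.\<close>

theorem theorem2p4:
  fixes \<phi> :: "'a::unital_cstar_algebra \<Rightarrow> 'b::unital_cstar_algebra"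
  shows "(boundedly_positive_type \<phi> \<longleftrightarrow>
           (\<exists>(C :: ('a \<Rightarrow> 'a \<Rightarrow> 'b) cstar_structure) \<phi>\<^sub>1 \<phi>\<^sub>2.
              unital_cstar_structure C \<and> star_multiplicative_into C \<phi>\<^sub>1 \<and>
              positive_linear_from C \<phi>\<^sub>2 \<and> \<phi> = \<phi>\<^sub>2 \<circ> \<phi>\<^sub>1))
       \<and> ((\<exists>(C :: 'c cstar_structure) \<phi>\<^sub>1 \<phi>\<^sub>2.
              unital_cstar_structure C \<and> star_multiplicative_into C \<phi>\<^sub>1 \<and>
              positive_linear_from C \<phi>\<^sub>2 \<and> \<phi> = \<phi>\<^sub>2 \<circ> \<phi>\<^sub>1)
           \<longrightarrow> boundedly_positive_type \<phi>)"
proof (intro conjI iffI impI)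
  assume "boundedly_positive_type \<phi>"
  then interpret boundedly_positive \<phi> by (rule boundedly_positive.intro)
  from factorization
  show "\<exists>(C :: ('a \<Rightarrow> 'a \<Rightarrow> 'b) cstar_structure) \<phi>\<^sub>1 \<phi>\<^sub>2.
      unital_cstar_structure C \<and> star_multiplicative_into C \<phi>\<^sub>1 \<and>
      positive_linear_from C \<phi>\<^sub>2 \<and> \<phi> = \<phi>\<^sub>2 \<circ> \<phi>\<^sub>1"
    by blast
qed (auto intro: unital_cstar_structure.boundedly_positive_type_comp)

end
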